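(* Let $\mathcal{X}$, $K$, $\mathcal{H}$, $\kappa$, $\mu_\infty$, the i.i.d. sample $x_1,x_2,\dots$ drawn from $\mu_\infty$, the operators $W_c$ and $W_{c,m}$, and the functions $L_{c,m}^{\lambda}$, $L_c^{\lambda}$, $L_c$ be as specified in the context. Then the following hold. (i) Fix $\lambda>0$, and let $m\ge 1$ and $\delta\in(0,1]$. For each $x\in\mathcal{X}$, with probability at least $1-\delta$ over the draw of $x_1,\dots,x_m$, $$\bigl|L_{c,m}^{\lambda}(x)-L_c^{\lambda}(x)\bigr|\;\le\;\frac{2\sqrt{2}\,\kappa^4(\lambda^2+\kappa^4)}{\lambda^4\sqrt{m}}\,\log^{1/2}\frac{2}{\delta}.$$ (ii) If $(K,\mathcal{X},\mu_\infty)$ is such that $$\sup_{x\in\mathcal{X}}\bigl\|W_c^{\dagger}(W_c^{\dagger}W_c)K_x\bigr\|_{\mathcal{H}}<\infty,\qquad (\ast)$$ then for all $x\in\mathcal{X}$, $$\lim_{\lambda\to 0^+}\bigl|L_c^{\lambda}(x)-L_c(x)\bigr|=0.$$ (iii) If condition $(\ast)$ holds and $\{\lambda_m\}_m$ is a sequence of positive real numbers satisfying $\lim_{m\to\infty}\lambda_m=0$ and $$\lim_{m\to\infty}\frac{\log^{1/2}m}{\lambda_m\sqrt{m}}=0,$$ then for each $x\in\mathcal{X}$, $$\lim_{m\to\infty}\bigl|L_{c,m}^{\lambda_m}(x)-L_c(x)\bigr|=0\quad\text{almost surely.}$$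
   Context: **Setting and data.** Let $\mathcal{X}\subset\mathbb{R}^n$ be compact (the statespace). Let $\mu_\infty$ be a Borel probability measure on $\mathcal{X}$, namely the (unknown) invariant measure of a nonlinear control system $\dot x=F(x,u)$, $y=h(x)$, with $x\in\mathbb{R}^n$, $u\in\mathbb{R}^q$, $y\in\mathbb{R}^p$, $F(0,0)=0$, $h(0)=0$, when the input $u$ is replaced by white Gaussian noise. The linearization of the system at the origin is assumed controllable and observable, and $\frac{\partial F}{\partial x}|_{x=0}$ asymptotically stable. The system enters the statement only through $\mu_\infty$. The samples $x_1,x_2,\dots$ are independent random draws from $\mu_\infty$; probabilities and "almost surely" refer to these draws. **Kernel.** $K:\mathcal{X}\times\mathcal{X}\to\mathbb{R}$ is a (symmetric, positive semidefinite) reproducing kernel, with real reproducing kernel Hilbert space (RKHS) $\mathcal{H}$ of functions on $\mathcal{X}$ and $K_x:=K(x,\cdot)\in\mathcal{H}$, so that $f(x)=\langle f,K_x\rangle$ for all $f\in\mathcal{H}$, $x\in\mathcal{X}$. It is assumed that $K$ is locally Lipschitz and measurable, that $$\kappa^2:=\sup_{x\in\mathcal{X}}K(x,x)<\infty,$$ and that $\mathcal{H}$ is completely regular, i.e. for every closed set $C\subseteq\mathcal{X}$ and every $x_0\in\mathcal{X}\setminus C$ there is $f\in\mathcal{H}$ with $f(x_0)\neq 0$ and $f(x)=0$ for all $x\in C$. (The space $\mathcal{H}$ is then separable.) **Gramians.** The RKHS controllability gramian and its empirical version from $m$ samples are the bounded, self-adjoint, positive operators on $\mathcal{H}$ $$W_c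 h=\int_{\mathcal{X}}\langle h,K_x\rangle K_x\,d\mu_\infty(x),\qquad W_{c,m}h=\frac1m\sum_{i=1}^m\langle h,K_{x_i}\rangle K_{x_i},\qquad h\in\mathcal{H}.$$ **Pseudoinverse convention.** $W_c^{\dagger}$ is the pseudoinverse of the compact self-adjoint operator $W_c$: if $\{\sigma_i,\phi_i\}$ is an orthonormal eigensystem of $W_c$, then $W_c^{\dagger}h=\sum_{i:\sigma_i>0}\sigma_i^{-1}\langle\phi_i,h\rangle\phi_i$ whenever this series converges in $\mathcal{H}$. The operator $W_c^{\dagger}W_c$ is the orthogonal projection onto the closure of the range of $W_c$. Finiteness of $\|W_c^{\dagger}(W_c^{\dagger}W_c)K_x\|_{\mathcal{H}}$ means that $(W_c^{\dagger}W_c)K_x$ lies in the domain of $W_c^{\dagger}$, i.e. $\sum_{i:\sigma_i>0}\sigma_i^{-2}|\langle\phi_i,K_x\rangle|^2<\infty$, the norm being understood as $+\infty$ otherwise. **Energy functions.** For $x\in\mathcal{X}$ and $\lambda>0$ define $$L_{c,m}^{\lambda}(x)=\tfrac12\bigl\langle (W_{c,m}+\lambda I)^{-2}W_{c,m}K_x,K_x\bigr\rangle=\tfrac{1}{2m}\,\mathbf{k}(x)^{\top}\bigl(\tfrac1m K_m+\lambda I\bigr)^{-2}\mathbf{k}(x),$$ where $\mathbf{k}(x)=(K(x,x_i))_{i=1}^m\in\mathbb{R}^m$ and $K_m=(K(x_i,x_j))_{i,j=1}^m$; $$L_c^{\lambda}(x)=\tfrac12\bigl\langle (W_c+\lambda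 I)^{-2}W_cK_x,K_x\bigr\rangle;$$ and, when the expression is well defined, $$L_c(x)=\tfrac12\bigl\langle W_c^{\dagger}(W_c^{\dagger}W_c)K_x,K_x\bigr\rangle.$$ *)

theory Defs
  imports "HOL-Probability.Probability"
begin

definition locally_lipschitz_on :: "'a::metric_space set \<Rightarrow> ('a \<Rightarrow> 'b::metric_space) \<Rightarrow> bool" where
  "locally_lipschitz_on S f \<longleftrightarrow>
     (\<forall>x\<in>S. \<exists>r>0. \<exists>L. lipschitz_on L (cball x r \<inter> S) f)"

definition psd_kernel :: "'x set \<Rightarrow> ('x \<Rightarrow> 'x \<Rightarrow> real) \<Rightarrow> bool" where
  "psd_kernel X K \<longleftrightarrow>
     (\<forall>x\<in>X. \<forall>y\<in>X. K x y = K y x) \<and>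
     (\<forall>S c. finite S \<and> S \<subseteq> X \<longrightarrow> 0 \<le> (\<Sum>x\<in>S. \<Sum>y\<in>S. c x * c y * K x y))"

text \<open>
  A Hilbert space of functions on \<open>X\<close> is given by a type \<open>'h\<close> of vectors together with a map
  \<open>evl\<close> sending a vector to the function it denotes. Only the values on \<open>X\<close> matter: \<open>evl\<close> is linear
  and injective as a map into functions on \<open>X\<close>. The vector \<open>k x\<close> is the function \<open>K x\<close>;
  it is determined by \<open>evl\<close> and \<open>K\<close>.
\<close>

definition rkhs ::
  "'x set \<Rightarrow> ('x \<Rightarrow> 'x \<Rightarrow> real) \<Rightarrow> ('h::{real_inner,complete_space} \<Rightarrow> 'x \<Rightarrow> real) \<Rightarrow> ('x \<Rightarrow> 'h) \<Rightarrow> bool"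
where
  "rkhs X K evl k \<longleftrightarrow>
     (\<forall>x\<in>X. linear (\<lambda>f. evl f x)) \<and>
     (\<forall>f. (\<forall>x\<in>X. evl f x = 0) \<longrightarrow> f = 0) \<and>
     (\<forall>x\<in>X. \<forall>y\<in>X. evl (k x) y = K x y) \<and>
     (\<forall>f. \<forall>x\<in>X. evl f x = f \<bullet> k x)"

definition completely_regular_rkhs :: "'x::topological_space set \<Rightarrow> ('h \<Rightarrow> 'x \<Rightarrow> real) \<Rightarrow> bool" where
  "completely_regular_rkhs X evl \<longleftrightarrow>
     (\<forall>C x0. closedin (top_of_set X) C \<and> x0 \<in> X - C \<longrightarrow>
        (\<exists>f. evl f x0 \<noteq> 0 \<and> (\<forall>x\<in>C. evl f x = 0)))"

definition kernel_bound :: "'x set \<Rightarrow> ('x \<Rightarrow> 'x \<Rightarrow> real) \<Rightarrow> real" where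
  "kernel_bound X K = sqrt (SUP x\<in>X. K x x)"

definition gramian ::
  "'x measure \<Rightarrow> ('x \<Rightarrow> 'h) \<Rightarrow> 'h \<Rightarrow> 'h::{real_inner,complete_space,second_countable_topology}" where
  "gramian \<mu> k h = (\<integral>x. (h \<bullet> k x) *\<^sub>R k x \<partial>\<mu>)"

definition emp_gramian :: "('x \<Rightarrow> 'h::real_inner) \<Rightarrow> (nat \<Rightarrow> 'x) \<Rightarrow> nat \<Rightarrow> 'h \<Rightarrow> 'h" where
  "emp_gramian k xs m h = (1 / real m) *\<^sub>R (\<Sum>i=1..m. (h \<bullet> k (xs i)) *\<^sub>R k (xs i))"

text \<open>
  The eigenvectors form an orthonormal basis of the whole space, those with eigenvalue \<open>0\<close>
  included. Indices range over an arbitrary, possibly finite, set of naturals, which is enough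
  in a separable space.
\<close>

definition orthonormal_eigensystem ::
  "('h::real_inner \<Rightarrow> 'h) \<Rightarrow> nat set \<Rightarrow> (nat \<Rightarrow> real) \<Rightarrow> (nat \<Rightarrow> 'h) \<Rightarrow> bool" where
  "orthonormal_eigensystem W I \<sigma> \<phi> \<longleftrightarrow>
     (\<forall>i\<in>I. \<forall>j\<in>I. \<phi> i \<bullet> \<phi> j = (if i = j then 1 else 0)) \<and>
     (\<forall>i\<in>I. W (\<phi> i) = \<sigma> i *\<^sub>R \<phi> i) \<and>
     closure (span (\<phi> ` I)) = UNIV"

text \<open>
  For a compact, self-adjoint and positive operator \<open>W\<close> an eigensystem exists, and neither
  convergence nor the sum of the series depends on its choice, so that the pseudoinverse is a
  partial function with domain \<open>pinv_dom W\<close>. Outside this domain the value of \<open>pinv W\<close>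
  is unspecified, and \<open>pinv_norm\<close> is infinite.
\<close>

definition pinv_graph :: "('h::real_inner \<Rightarrow> 'h) \<Rightarrow> 'h \<Rightarrow> 'h \<Rightarrow> bool" where
  "pinv_graph W h y \<longleftrightarrow>
     (\<exists>I \<sigma> \<phi>. orthonormal_eigensystem W I \<sigma> \<phi> \<and>
        ((\<lambda>i. (inverse (\<sigma> i) * (\<phi> i \<bullet> h)) *\<^sub>R \<phi> i) has_sum y) {i\<in>I. \<sigma> i > 0})"

definition pinv_dom :: "('h::real_inner \<Rightarrow> 'h) \<Rightarrow> 'h set" where
  "pinv_dom W = {h. \<exists>y. pinv_graph W h y}"

definition pinv :: "('h::real_inner \<Rightarrow> 'h) \<Rightarrow> 'h \<Rightarrow> 'h" where
  "pinv W h = (THE y. pinv_graph W h y)"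

definition pinv_norm :: "('h::real_inner \<Rightarrow> 'h) \<Rightarrow> 'h \<Rightarrow> ennreal" where
  "pinv_norm W h = (if h \<in> pinv_dom W then ennreal (norm (pinv W h)) else \<infinity>)"

definition reg_inverse :: "('h::real_inner \<Rightarrow> 'h) \<Rightarrow> real \<Rightarrow> 'h \<Rightarrow> 'h" where
  "reg_inverse W l = inv (\<lambda>h. W h + l *\<^sub>R h)"

definition reg_energy :: "('h::real_inner \<Rightarrow> 'h) \<Rightarrow> ('x \<Rightarrow> 'h) \<Rightarrow> real \<Rightarrow> 'x \<Rightarrow> real" where
  "reg_energy W k l x = 1 / 2 * ((reg_inverse W l ^^ 2) (W (k x)) \<bullet> k x)"

definition energy :: "('h::real_inner \<Rightarrow> 'h) \<Rightarrow> ('x \<Rightarrow> 'h) \<Rightarrow> 'x \<Rightarrow> real" where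
  "energy W k x = 1 / 2 * (pinv W (pinv W (W (k x))) \<bullet> k x)"

end

theory Submission
  imports Defs
begin

text \<open>
  Write \<open>v = k x\<close> and let \<open>R\<close>, \<open>R\<^sub>m\<close> be the resolvents \<open>(W + l I)\<inverse>\<close> and \<open>(W\<^sub>m + l I)\<inverse>\<close>. All three
  claims compare vectors of the form \<open>R\<^sup>2 W v\<close>, and the guiding observation is that such a comparison
  only ever meets the random operator \<open>W\<^sub>m\<close> applied to finitely or countably many deterministic
  vectors. The sample average \<open>W\<^sub>m u\<close> of the independent vectors \<open>(u \<bullet> k x\<^sub>i) k x\<^sub>i\<close> has mean \<open>W u\<close>, so a
  Hoeffding inequality for sums of Hilbert space valued vectors (\<open>hilbert_hoeffding\<close>) is the only
  probabilistic input.

  For the finite sample bound, put \<open>w = R\<^sup>2 v\<close>. Then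
  \<open>R\<^sub>m\<^sup>2 W\<^sub>m v - R\<^sup>2 W v = R\<^sub>m\<^sup>2 (W\<^sub>m (W - W\<^sub>m) W w + l\<^sup>2 (W\<^sub>m - W) w)\<close>
  (\<open>tikhonov_perturbation\<close>), so two deviations, at \<open>W w\<close> and at \<open>w\<close>, have to be small at once. The
  factor \<open>1/2\<close> in the energy leaves enough room in the constant for a union bound over these two events.

  Under the finiteness condition, \<open>g = pinv W (pinv W (W v))\<close> lies in the closure of the range of
  \<open>W\<close>, and \<open>v - W g\<close> lies in the kernel of \<open>W\<close> (\<open>pinv_pinv_range\<close>); the energy is \<open>(g \<bullet> v) / 2\<close>. Almost
  every feature vector is orthogonal to that kernel, so \<open>W\<^sub>m v = W\<^sub>m W g\<close> almost surely, and
  \<open>R\<^sub>m\<^sup>2 W\<^sub>m W g\<close> differs from \<open>R\<^sub>m\<^sup>2 W\<^sub>m\<^sup>2 g\<close> by at most \<open>\<parallel>(W\<^sub>m - W) g\<parallel> / l\<close>. It remains to see that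
  \<open>R\<^sub>m\<^sup>2 W\<^sub>m\<^sup>2 g\<close> tends to \<open>g\<close>: the operators \<open>I - R\<^sub>m\<^sup>2 W\<^sub>m\<^sup>2\<close> are uniformly bounded and of size \<open>O(l)\<close> on the
  range of \<open>W\<^sub>m\<close>, and \<open>g\<close> is a limit of vectors \<open>W u\<close>, which are close to \<open>W\<^sub>m u\<close>. This argument
  (\<open>tikhonov_tendsto\<close>) is run along an arbitrary filter: with \<open>W\<close> in place of \<open>W\<^sub>m\<close> and \<open>l \<rightarrow> 0\<close> it gives
  the deterministic limit, and along \<open>m \<rightarrow> \<infinity>\<close> it gives the almost sure limit, where the Borel-Cantelli
  lemma and the rate condition on the regularisation parameters make \<open>\<parallel>(W\<^sub>m - W) g\<parallel> / l\<^sub>m\<close> vanish.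
\<close>

section \<open>Resolvents of positive operators\<close>

text \<open>
  One step of Richardson's iteration for the equation \<open>A h + l h = z\<close>. Its step size depends on the
  bound \<open>M\<close> only, so that for a random operator every iterate is a measurable function of the
  operator; the resolvent, being their limit, is then measurable too.
\<close>
definition richardson :: "('h::real_vector \<Rightarrow> 'h) \<Rightarrow> real \<Rightarrow> real \<Rightarrow> 'h \<Rightarrow> 'h \<Rightarrow> 'h" where
  "richardson A M l z h = h - (l / (M + l)\<^sup>2) *\<^sub>R (A h + l *\<^sub>R h - z)"

locale positive_operator =
  fixes A :: "'h::{real_inner,complete_space} \<Rightarrow> 'h" and M :: real
  assumes linear: "linear A"
    and symmetric: "A x \<bullet> y = x \<bullet> A y"
    and nonneg: "0 \<le> A x \<bullet> x"
    and bounded: "norm (A x) \<le> M * norm x"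
    and bound_nonneg: "0 \<le> M"
begin

definition rate :: "real \<Rightarrow> real" where
  "rate l = sqrt (1 - l\<^sup>2 / (M + l)\<^sup>2)"

context
  fixes l :: real
  assumes l: "l > 0"
begin

lemma rate_bounds: "0 \<le> rate l" "rate l < 1"
proof -
  have "l\<^sup>2 \<le> (M + l)\<^sup>2"
    using l bound_nonneg by (intro power_mono) auto
  then show "0 \<le> rate l" "rate l < 1"
    using l bound_nonneg by (auto simp: rate_def divide_le_eq)
qed

text \<open>
  The operator \<open>T = A + l I\<close> satisfies \<open>T d \<bullet> d \<ge> l \<parallel>d\<parallel>\<^sup>2\<close> and \<open>\<parallel>T d\<parallel> \<le> (M + l) \<parallel>d\<parallel>\<close>. Hence
  \<open>\<parallel>d - s T d\<parallel>\<^sup>2 \<le> (1 - 2 s l + s\<^sup>2 (M + l)\<^sup>2) \<parallel>d\<parallel>\<^sup>2\<close>, and the step size minimises the right-hand side.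
\<close>
lemma richardson_contraction:
  "norm (richardson A M l z h - richardson A M l z h') \<le> rate l * norm (h - h')"
proof -
  define d where "d = h - h'"
  define s where "s = l / (M + l)\<^sup>2"
  define T where "T = A d + l *\<^sub>R d"
  have pos: "M + l > 0"
    using l bound_nonneg by simp
  have s0: "s \<ge> 0"
    using l by (simp add: s_def)
  have "richardson A M l z h - richardson A M l z h' = d - s *\<^sub>R T"
    by (simp add: richardson_def d_def s_def T_def linear_diff[OF linear] algebra_simps)
  moreover have "(norm (d - s *\<^sub>R T))\<^sup>2 \<le> (rate l * norm d)\<^sup>2"
  proof -
    have "norm T \<le> (M + l) * norm d"
      using norm_triangle_ineq[of "A d" "l *\<^sub>R d"] bounded[of d] l
      by (simp add: T_def algebra_simps)
    then have T: "(norm T)\<^sup>2 \<le> (M + l)\<^sup>2 * (norm d)\<^sup>2"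
      using power_mono[of "norm T" "(M + l) * norm d" 2] by (simp add: power_mult_distrib)
    have Td: "T \<bullet> d \<ge> l * (norm d)\<^sup>2"
      using nonneg[of d] by (simp add: T_def inner_add_left power2_norm_eq_inner)
    have "(norm (d - s *\<^sub>R T))\<^sup>2 = (norm d)\<^sup>2 - 2 * s * (T \<bullet> d) + s\<^sup>2 * (norm T)\<^sup>2"
      using dot_norm_neg[of d "s *\<^sub>R T"] s0
      by (simp add: inner_commute[of d] power_mult_distrib field_simps)
    also have "\<dots> \<le> (norm d)\<^sup>2 - 2 * s * (l * (norm d)\<^sup>2) + s\<^sup>2 * ((M + l)\<^sup>2 * (norm d)\<^sup>2)"
      using T Td s0 by (intro add_mono diff_mono mult_left_mono) auto
    also have "\<dots> = (1 - l\<^sup>2 / (M + l)\<^sup>2) * (norm d)\<^sup>2"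
    proof -
      have "s\<^sup>2 * ((M + l)\<^sup>2 * (norm d)\<^sup>2) = s * (s * (M + l)\<^sup>2) * (norm d)\<^sup>2"
        by (simp add: power2_eq_square mult_ac)
      also have "s * (M + l)\<^sup>2 = l"
        using pos by (simp add: s_def)
      finally have "s\<^sup>2 * ((M + l)\<^sup>2 * (norm d)\<^sup>2) = s * l * (norm d)\<^sup>2" .
      moreover have "l\<^sup>2 / (M + l)\<^sup>2 = s * l"
        by (simp add: s_def power2_eq_square)
      ultimately show ?thesis
        by (simp only:) (simp add: algebra_simps)
    qed
    also have "\<dots> = (rate l * norm d)\<^sup>2"
      using rate_bounds(1) by (simp add: rate_def power_mult_distrib)
    finally show ?thesis .
  qed
  ultimately show ?thesis
    using rate_bounds(1) by (metis d_def mult_nonneg_nonneg norm_ge_zero power2_le_imp_le)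
qed

lemma richardson_fixpoint_iff: "richardson A M l z h = h \<longleftrightarrow> A h + l *\<^sub>R h = z"
  using l bound_nonneg by (auto simp: richardson_def)

lemma bij_shift: "bij (\<lambda>h. A h + l *\<^sub>R h)"
proof (rule bijI)
  show "inj (\<lambda>h. A h + l *\<^sub>R h)"
  proof (rule injI)
    fix h h'
    assume "A h + l *\<^sub>R h = A h' + l *\<^sub>R h'"
    then have "norm (h - h') \<le> rate l * norm (h - h')"
      using richardson_contraction[of "A h + l *\<^sub>R h" h h'] richardson_fixpoint_iff by metis
    moreover have "rate l * norm (h - h') < norm (h - h')" if "h \<noteq> h'"
      using that rate_bounds(2) by simp
    ultimately show "h = h'"
      by (metis less_le_not_le)
  qed
  show "surj (\<lambda>h. A h + l *\<^sub>R h)"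
    unfolding surj_def
  proof
    fix z
    have "\<exists>!h. richardson A M l z h = h"
      using rate_bounds richardson_contraction
      by (intro banach_fix_type[of "rate l"]) (auto simp: dist_norm)
    then show "\<exists>h. z = A h + l *\<^sub>R h"
      using richardson_fixpoint_iff by metis
  qed
qed

lemma shift_resolvent: "A (reg_inverse A l z) + l *\<^sub>R reg_inverse A l z = z"
  using surj_f_inv_f[OF bij_is_surj[OF bij_shift], of z] by (simp add: reg_inverse_def)

lemma resolvent_eqI: "A h + l *\<^sub>R h = z \<Longrightarrow> reg_inverse A l z = h"
  unfolding reg_inverse_def using inv_f_f[OF bij_is_inj[OF bij_shift], of h] by simp

lemma richardson_tendsto:
  "(\<lambda>n. (richardson A M l z ^^ n) h) \<longlonglongrightarrow> reg_inverse A l z"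
proof -
  let ?r = "reg_inverse A l z"
  have fixpoint: "richardson A M l z ?r = ?r"
    by (simp add: richardson_fixpoint_iff shift_resolvent)
  have "norm ((richardson A M l z ^^ n) h - ?r) \<le> rate l ^ n * norm (h - ?r)" for n
  proof (induction n)
    case (Suc n)
    have "norm ((richardson A M l z ^^ Suc n) h - ?r) \<le> rate l * norm ((richardson A M l z ^^ n) h - ?r)"
      using richardson_contraction[of z "(richardson A M l z ^^ n) h" ?r] fixpoint by simp
    also have "\<dots> \<le> rate l * (rate l ^ n * norm (h - ?r))"
      by (intro mult_left_mono Suc.IH rate_bounds)
    finally show ?case by simp
  qed simp
  moreover have "(\<lambda>n. rate l ^ n * norm (h - ?r)) \<longlonglongrightarrow> 0"
    using rate_bounds by (intro tendsto_mult_left_zero LIMSEQ_realpow_zero) auto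
  ultimately have "(\<lambda>n. (richardson A M l z ^^ n) h - ?r) \<longlonglongrightarrow> 0"
    by (rule Lim_null_comparison[OF always_eventually[OF allI]])
  then show ?thesis
    by (rule LIM_zero_cancel)
qed

lemma linear_resolvent: "linear (reg_inverse A l)"
proof (rule linearI)
  fix x y c
  show "reg_inverse A l (x + y) = reg_inverse A l x + reg_inverse A l y"
    using shift_resolvent[of x] shift_resolvent[of y]
    by (intro resolvent_eqI) (simp add: linear_add[OF linear] algebra_simps)
  have "c *\<^sub>R (A (reg_inverse A l x) + l *\<^sub>R reg_inverse A l x) = c *\<^sub>R x"
    by (simp add: shift_resolvent)
  then show "reg_inverse A l (c *\<^sub>R x) = c *\<^sub>R reg_inverse A l x"
    by (intro resolvent_eqI) (simp add: linear_scale[OF linear] algebra_simps)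
qed

lemma resolvent_commute: "reg_inverse A l (A z) = A (reg_inverse A l z)"
proof (rule resolvent_eqI)
  have "A (A (reg_inverse A l z) + l *\<^sub>R reg_inverse A l z) = A z"
    by (simp add: shift_resolvent)
  then show "A (A (reg_inverse A l z)) + l *\<^sub>R A (reg_inverse A l z) = A z"
    by (simp add: linear_add[OF linear] linear_scale[OF linear])
qed

lemma norm_resolvent_le: "norm (reg_inverse A l z) \<le> norm z / l"
proof -
  let ?h = "reg_inverse A l z"
  have "l * (norm ?h)\<^sup>2 \<le> z \<bullet> ?h"
    using arg_cong[OF shift_resolvent[of z], of "\<lambda>u. u \<bullet> ?h"] nonneg[of ?h]
    by (simp add: inner_add_left power2_norm_eq_inner)
  also have "\<dots> \<le> norm z * norm ?h"
    by (rule norm_cauchy_schwarz)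
  finally have "l * norm ?h \<le> norm z"
    by (cases "norm ?h = 0") (simp_all add: power2_eq_square)
  then show ?thesis
    using l by (simp add: field_simps)
qed

lemma norm_operator_resolvent_le: "norm (A (reg_inverse A l z)) \<le> norm z"
proof -
  let ?h = "reg_inverse A l z"
  have "(norm (A ?h + l *\<^sub>R ?h))\<^sup>2 = (norm (A ?h))\<^sup>2 + 2 * l * (A ?h \<bullet> ?h) + (l * norm ?h)\<^sup>2"
    using dot_norm[of "A ?h" "l *\<^sub>R ?h"] l by (simp add: field_simps)
  moreover have "0 \<le> 2 * l * (A ?h \<bullet> ?h)"
    using l nonneg[of ?h] by simp
  ultimately have "(norm (A ?h))\<^sup>2 \<le> (norm (A ?h + l *\<^sub>R ?h))\<^sup>2"
    using zero_le_power2[of "l * norm ?h"] by linarith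
  then have "norm (A ?h) \<le> norm (A ?h + l *\<^sub>R ?h)"
    by (rule power2_le_imp_le) simp
  then show ?thesis
    by (simp only: shift_resolvent)
qed

end

end

section \<open>The pseudoinverse of a positive operator\<close>

lemma orthonormal_sum_norm:
  fixes \<phi> :: "'i \<Rightarrow> 'h::real_inner"
  assumes "finite F"
    and "\<And>i j. i \<in> F \<Longrightarrow> j \<in> F \<Longrightarrow> \<phi> i \<bullet> \<phi> j = (if i = j then 1 else 0)"
  shows "(norm (\<Sum>i\<in>F. a i *\<^sub>R \<phi> i))\<^sup>2 = (\<Sum>i\<in>F. (a i)\<^sup>2)"
proof -
  have "(\<Sum>i\<in>F. a i *\<^sub>R \<phi> i) \<bullet> (\<Sum>j\<in>F. a j *\<^sub>R \<phi> j)
      = (\<Sum>i\<in>F. \<Sum>j\<in>F. a i * (a j * (\<phi> j \<bullet> \<phi> i)))"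
    by (simp add: inner_sum_left inner_sum_right sum_distrib_left)
  also have "\<dots> = (\<Sum>i\<in>F. \<Sum>j\<in>F. if i = j then (a i)\<^sup>2 else 0)"
    using assms(2) by (intro sum.cong) (auto simp: power2_eq_square)
  finally show ?thesis
    using assms(1) by (simp add: power2_norm_eq_inner)
qed

lemma bessel_inequality:
  fixes \<phi> :: "'i \<Rightarrow> 'h::real_inner"
  assumes F: "finite F"
    and orth: "\<And>i j. i \<in> F \<Longrightarrow> j \<in> F \<Longrightarrow> \<phi> i \<bullet> \<phi> j = (if i = j then 1 else 0)"
  shows "(\<Sum>i\<in>F. (\<phi> i \<bullet> h)\<^sup>2) \<le> (norm h)\<^sup>2"
proof -
  define s where "s = (\<Sum>i\<in>F. (\<phi> i \<bullet> h) *\<^sub>R \<phi> i)"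
  have "h \<bullet> s = (\<Sum>i\<in>F. (\<phi> i \<bullet> h)\<^sup>2)"
    by (simp add: s_def inner_sum_right power2_eq_square inner_commute)
  moreover have "(norm s)\<^sup>2 = (\<Sum>i\<in>F. (\<phi> i \<bullet> h)\<^sup>2)"
    unfolding s_def by (rule orthonormal_sum_norm[OF F orth])
  ultimately show ?thesis
    using dot_norm_neg[of h s] zero_le_power2[of "norm (h - s)"] by (simp add: field_simps)
qed

text \<open>
  By Pythagoras a finite partial sum over new indices has squared norm equal to the sum of the
  squared coefficients, which is a tail of a convergent series by Bessel's inequality. So the
  partial sums are Cauchy along the filter of finite index sets.
\<close>
lemma orthonormal_expansion_summable:
  fixes \<phi> :: "'i \<Rightarrow> 'h::{real_inner,complete_space}"
  assumes orth: "\<And>i j. i \<in> A \<Longrightarrow> j \<in> A \<Longrightarrow> \<phi> i \<bullet> \<phi> j = (if i = j then 1 else 0)"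
  shows "(\<lambda>i. (\<phi> i \<bullet> h) *\<^sub>R \<phi> i) summable_on A"
proof -
  define f where "f = (\<lambda>i. (\<phi> i \<bullet> h) *\<^sub>R \<phi> i)"
  define a where "a = (\<lambda>i. (\<phi> i \<bullet> h)\<^sup>2)"
  have "a summable_on A"
    unfolding a_def
  proof (intro nonneg_bdd_above_summable_on bdd_aboveI2)
    fix F assume "F \<in> {F. F \<subseteq> A \<and> finite F}"
    then show "(\<Sum>i\<in>F. (\<phi> i \<bullet> h)\<^sup>2) \<le> (norm h)\<^sup>2"
      by (intro bessel_inequality orth) auto
  qed auto
  then obtain S where S: "(a has_sum S) A"
    by (auto simp: summable_on_def)
  have norm_f: "(norm (sum f F))\<^sup>2 = sum a F" if "finite F" "F \<subseteq> A" for F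
    unfolding f_def a_def using that by (intro orthonormal_sum_norm orth) auto
  have "\<exists>P. eventually P (finite_subsets_at_top A) \<and>
          (\<forall>F F'. P F \<and> P F' \<longrightarrow> dist (sum f F) (sum f F') < e)" if "e > 0" for e
  proof -
    have "eventually (\<lambda>F. dist (sum a F) S < (e / 2)\<^sup>2 / 2) (finite_subsets_at_top A)"
      using S \<open>e > 0\<close> unfolding has_sum_def by (intro tendstoD) auto
    then obtain F0 where F0: "finite F0" "F0 \<subseteq> A"
      and near: "\<And>F. finite F \<Longrightarrow> F0 \<subseteq> F \<Longrightarrow> F \<subseteq> A \<Longrightarrow> dist (sum a F) S < (e / 2)\<^sup>2 / 2"
      unfolding eventually_finite_subsets_at_top by metis
    define P where "P = (\<lambda>F. finite F \<and> F0 \<subseteq> F \<and> F \<subseteq> A)"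
    have close: "dist (sum f F) (sum f F0) < e / 2" if "P F" for F
    proof -
      have F: "finite F" "F0 \<subseteq> F" "F \<subseteq> A"
        using that by (auto simp: P_def)
      have "(norm (sum f (F - F0)))\<^sup>2 = sum a F - sum a F0"
        using F F0 by (subst norm_f) (auto simp: sum_diff)
      also have "\<dots> < (e / 2)\<^sup>2"
      proof -
        have "sum a F - S < (e / 2)\<^sup>2 / 2" "S - sum a F0 < (e / 2)\<^sup>2 / 2"
          using near[OF F] near[OF F0(1) order_refl F0(2)]
          unfolding dist_real_def by (simp_all only: abs_less_iff minus_diff_eq)
        then show ?thesis by argo
      qed
      finally have "norm (sum f (F - F0)) < e / 2"
        by (rule power2_less_imp_less) (use \<open>e > 0\<close> in linarith)
      then show ?thesis
        unfolding dist_norm sum_diff[OF F(1,2)] .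
    qed
    have "dist (sum f F) (sum f F') < e" if "P F" "P F'" for F F'
      using close[OF that(1)] close[OF that(2)]
        dist_triangle2[of "sum f F" "sum f F'" "sum f F0"] by linarith
    moreover have "eventually P (finite_subsets_at_top A)"
      unfolding P_def eventually_finite_subsets_at_top using F0 by blast
    ultimately show ?thesis
      by blast
  qed
  then have "cauchy_filter (filtermap (sum f) (finite_subsets_at_top A))"
    by (simp add: cauchy_filter_metric_filtermap)
  moreover have "uniform_space_class.complete (UNIV :: 'h set)"
    by (meson Cauchy_convergent UNIV_I complete_def convergent_def)
  ultimately obtain L where "(sum f \<longlongrightarrow> L) (finite_subsets_at_top A)"
    using complete_uniform[where S = UNIV] by (force simp add: filterlim_def)
  then show ?thesis
    unfolding f_def[symmetric] summable_on_def has_sum_def by blast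
qed

context positive_operator
begin

lemma range_closure_orthogonal_kernel:
  assumes y: "y \<in> closure (range A)" and z: "A z = 0"
  shows "y \<bullet> z = 0"
proof -
  have "closure (range A) \<subseteq> {y. y \<bullet> z = 0}"
    by (intro closure_minimal closed_Collect_eq continuous_intros)
      (auto simp: symmetric z)
  then show ?thesis
    using y by auto
qed

text \<open>
  Every term of the series is a multiple of some \<open>\<phi> i\<close> with \<open>\<sigma> i > 0\<close>, which is the image of
  \<open>\<phi> i / \<sigma> i\<close>.
\<close>
lemma pinv_graph_range_closure:
  assumes "pinv_graph A h y"
  shows "y \<in> closure (range A)"
proof -
  obtain I \<sigma> \<phi> where ev: "orthonormal_eigensystem A I \<sigma> \<phi>"
    and y: "((\<lambda>i. (inverse (\<sigma> i) * (\<phi> i \<bullet> h)) *\<^sub>R \<phi> i) has_sum y) {i\<in>I. \<sigma> i > 0}"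
    using assms unfolding pinv_graph_def by blast
  have range: "subspace (range A)"
    using linear_subspace_image[OF linear subspace_UNIV] .
  have "c *\<^sub>R \<phi> i \<in> range A" if "i \<in> I" "\<sigma> i > 0" for i c
  proof -
    have "c *\<^sub>R \<phi> i = A ((c / \<sigma> i) *\<^sub>R \<phi> i)"
      using ev that by (simp add: orthonormal_eigensystem_def linear_scale[OF linear])
    then show ?thesis by blast
  qed
  then have "eventually (\<lambda>F. (\<Sum>i\<in>F. (inverse (\<sigma> i) * (\<phi> i \<bullet> h)) *\<^sub>R \<phi> i) \<in> closure (range A))
      (finite_subsets_at_top {i\<in>I. \<sigma> i > 0})"
    by (intro eventually_finite_subsets_at_top_weakI closure_subset[THEN subsetD]
        subspace_sum[OF range]) auto
  then show ?thesis
    using y unfolding has_sum_def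
    by (intro Lim_in_closed_set[OF closed_closure]) auto
qed

text \<open>
  Against an eigenvector with positive eigenvalue, \<open>h\<close> and \<open>A y\<close> have the same coefficient; an
  eigenvector with eigenvalue \<open>0\<close> is orthogonal to the range of \<open>A\<close>. As the eigenvectors span a dense
  subspace, this leaves no room for \<open>A (h - A y)\<close>.
\<close>
lemma pinv_graph_residual:
  assumes "pinv_graph A h y"
  shows "A (h - A y) = 0"
proof -
  obtain I \<sigma> \<phi> where ev: "orthonormal_eigensystem A I \<sigma> \<phi>"
    and y: "((\<lambda>i. (inverse (\<sigma> i) * (\<phi> i \<bullet> h)) *\<^sub>R \<phi> i) has_sum y) {i\<in>I. \<sigma> i > 0}"
    using assms unfolding pinv_graph_def by blast
  have eig: "A (\<phi> i) = \<sigma> i *\<^sub>R \<phi> i" if "i \<in> I" for i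
    using ev that by (auto simp: orthonormal_eigensystem_def)
  have orth: "\<phi> i \<bullet> \<phi> j = (if i = j then 1 else 0)" if "i \<in> I" "j \<in> I" for i j
    using ev that by (auto simp: orthonormal_eigensystem_def)
  have "A (h - A y) \<bullet> \<phi> j = 0" if j: "j \<in> I" for j
  proof (cases "\<sigma> j > 0")
    case True
    have "((\<lambda>i. (inverse (\<sigma> i) * (\<phi> i \<bullet> h)) *\<^sub>R \<phi> i \<bullet> \<phi> j) has_sum y \<bullet> \<phi> j) {i\<in>I. \<sigma> i > 0}"
      using has_sum_bounded_linear[OF bounded_linear_inner_left y] .
    moreover have "((\<lambda>i. (inverse (\<sigma> i) * (\<phi> i \<bullet> h)) *\<^sub>R \<phi> i \<bullet> \<phi> j)
        has_sum inverse (\<sigma> j) * (\<phi> j \<bullet> h)) {i\<in>I. \<sigma> i > 0}"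
      using has_sum_finite_neutralI[of "{j}" "{i\<in>I. \<sigma> i > 0}"
          "\<lambda>i. (inverse (\<sigma> i) * (\<phi> i \<bullet> h)) *\<^sub>R \<phi> i \<bullet> \<phi> j"] j True orth
      by auto
    ultimately have "y \<bullet> \<phi> j = inverse (\<sigma> j) * (\<phi> j \<bullet> h)"
      by (rule has_sum_unique)
    moreover have "A y \<bullet> \<phi> j = \<sigma> j * (y \<bullet> \<phi> j)"
      by (simp add: symmetric eig j)
    ultimately have "(h - A y) \<bullet> \<phi> j = 0"
      using True by (simp add: inner_diff_left inner_commute[of _ h])
    then show ?thesis
      by (simp add: symmetric eig j)
  next
    case False
    have "\<sigma> j \<ge> 0"
      using nonneg[of "\<phi> j"] by (simp add: eig j orth)
    then show ?thesis
      using False by (simp add: symmetric eig j)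
  qed
  then have "span (\<phi> ` I) \<subseteq> {u. A (h - A y) \<bullet> u = 0}"
    by (intro span_minimal subspaceI) (auto simp: inner_add_right)
  then have "closure (span (\<phi> ` I)) \<subseteq> {u. A (h - A y) \<bullet> u = 0}"
    by (intro closure_minimal closed_Collect_eq continuous_intros)
  moreover have "A (h - A y) \<in> closure (span (\<phi> ` I))"
    using ev by (simp add: orthonormal_eigensystem_def)
  ultimately have "A (h - A y) \<bullet> A (h - A y) = 0"
    by blast
  then show ?thesis
    by simp
qed

lemma kernel_square: "A (A z) = 0 \<Longrightarrow> A z = 0"
  using symmetric[of z "A z"] by simp

text \<open>
  Two values of the pseudoinverse, possibly computed from different eigensystems, differ by an
  element of the kernel that also lies in the closure of the range, hence is orthogonal to itself.
\<close>
lemma pinv_eqI: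
  assumes "pinv_graph A h y"
  shows "pinv A h = y"
  unfolding pinv_def
proof (rule the_equality, rule assms)
  fix y'
  assume y': "pinv_graph A h y'"
  let ?d = "y' - y"
  have "A (A ?d) = A (h - A y) - A (h - A y')"
    by (simp add: linear_diff[OF linear])
  also have "\<dots> = 0"
    using assms y' by (simp add: pinv_graph_residual)
  finally have "A ?d = 0"
    by (rule kernel_square)
  then have "?d \<bullet> ?d = 0"
    using range_closure_orthogonal_kernel pinv_graph_range_closure assms y'
    by (simp add: inner_diff_left)
  then show "y' = y"
    by simp
qed

text \<open>
  The series for \<open>A v\<close> is the orthonormal expansion of \<open>v\<close> along the eigenvectors with positive
  eigenvalue: the factors \<open>\<sigma> i\<close> and \<open>inverse (\<sigma> i)\<close> cancel.
\<close>
lemma pinv_graph_of_range: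
  assumes ev: "orthonormal_eigensystem A I \<sigma> \<phi>"
  obtains p where "pinv_graph A (A v) p"
proof -
  let ?J = "{i\<in>I. \<sigma> i > 0}"
  have "(\<lambda>i. (\<phi> i \<bullet> v) *\<^sub>R \<phi> i) summable_on ?J"
    using ev by (intro orthonormal_expansion_summable) (simp add: orthonormal_eigensystem_def)
  moreover have "(inverse (\<sigma> i) * (\<phi> i \<bullet> A v)) *\<^sub>R \<phi> i = (\<phi> i \<bullet> v) *\<^sub>R \<phi> i"
    if "i \<in> ?J" for i
    using that ev by (simp add: orthonormal_eigensystem_def flip: symmetric)
  ultimately have "(\<lambda>i. (inverse (\<sigma> i) * (\<phi> i \<bullet> A v)) *\<^sub>R \<phi> i) summable_on ?J"
    by (subst summable_on_cong)
  then show ?thesis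
    using ev that unfolding summable_on_def pinv_graph_def by blast
qed

text \<open>
  In operator notation \<open>g = pinv A (pinv A (A v))\<close> solves \<open>A g = Q v\<close>, where \<open>Q\<close> is the projection onto
  the closure of the range of \<open>A\<close>. The two conclusions express this without mentioning \<open>Q\<close>. Membership of
  \<open>pinv A (A v)\<close> in the domain is also what guarantees that an eigensystem exists, so that the inner
  pseudoinverse has its intended meaning.
\<close>
lemma pinv_pinv_range:
  assumes "pinv A (A v) \<in> pinv_dom A"
  shows "pinv A (pinv A (A v)) \<in> closure (range A)"
    and "A (v - A (pinv A (pinv A (A v)))) = 0"
proof -
  define p where "p = pinv A (A v)"
  obtain g where g: "pinv_graph A p g"
    using assms by (auto simp: pinv_dom_def p_def)
  then obtain I \<sigma> \<phi> where "orthonormal_eigensystem A I \<sigma> \<phi>"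
    unfolding pinv_graph_def by blast
  then obtain p' where p': "pinv_graph A (A v) p'"
    by (rule pinv_graph_of_range)
  then have p: "pinv_graph A (A v) p"
    unfolding p_def pinv_eqI[OF p'] .
  have "A (A (v - p)) = 0"
    using pinv_graph_residual[OF p] by (simp add: linear_diff[OF linear])
  then have "A (v - p) = 0"
    by (rule kernel_square)
  moreover have "A (p - A g) = 0"
    using pinv_graph_residual[OF g] .
  ultimately show "A (v - A (pinv A (pinv A (A v)))) = 0"
    unfolding p_def[symmetric] pinv_eqI[OF g] by (simp add: linear_diff[OF linear])
  show "pinv A (pinv A (A v)) \<in> closure (range A)"
    unfolding p_def[symmetric] pinv_eqI[OF g] by (rule pinv_graph_range_closure[OF g])
qed

end

section \<open>Tikhonov regularisation\<close>

context positive_operator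
begin

context
  fixes l :: real
  assumes l: "l > 0"
begin

abbreviation (input) "R \<equiv> reg_inverse A l"

lemma resolvent_residual: "z - A (R z) = l *\<^sub>R R z"
  using shift_resolvent[OF l, of z] by (simp add: algebra_simps)

lemma norm_resolvent2_operator_le: "norm (R (R (A z))) \<le> norm z / l"
proof -
  have "norm (R (R (A z))) \<le> norm (R (A z)) / l"
    by (rule norm_resolvent_le[OF l])
  also have "\<dots> \<le> norm z / l"
    using norm_operator_resolvent_le[OF l, of z] l
    by (intro divide_right_mono) (auto simp: resolvent_commute)
  finally show ?thesis .
qed

text \<open>
  With \<open>I - A R = l R\<close> the operator \<open>D = I - R\<^sup>2 A\<^sup>2 = (I - A R) (I + A R)\<close> equals \<open>l R (I + A R)\<close>. Since
  \<open>l R\<close> and \<open>A R\<close> are contractions, \<open>D\<close> has norm at most \<open>2\<close>, and on a vector \<open>A u\<close> it gains the factor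
  \<open>l\<close>. Splitting \<open>g = (g - A u) + A u\<close> gives the estimate, in which \<open>u\<close> is free to be chosen.
\<close>
lemma tikhonov_residual:
  "norm (g - R (R (A (A g)))) \<le> 2 * norm (g - A u) + 2 * l * norm u"
proof -
  define D where "D z = l *\<^sub>R R z + l *\<^sub>R A (R (R z))" for z
  have D: "z - R (R (A (A z))) = D z" for z
  proof -
    have "z - R (R (A (A z))) = (z - A (R z)) + A (R z - A (R (R z)))"
      by (simp add: resolvent_commute[OF l] linear_diff[OF linear])
    also have "\<dots> = D z"
      by (simp add: resolvent_residual D_def linear_scale[OF linear])
    finally show ?thesis .
  qed
  have D_add: "D (x + y) = D x + D y" for x y
    by (simp add: D_def linear_add[OF linear] linear_add[OF linear_resolvent[OF l]] algebra_simps)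
  have D_le: "norm (D z) \<le> l * (norm (R z) + norm (R z))" for z
  proof -
    have "norm (D z) \<le> l * norm (R z) + l * norm (A (R (R z)))"
      using norm_triangle_ineq[of "l *\<^sub>R R z" "l *\<^sub>R A (R (R z))"] l by (simp add: D_def)
    also have "\<dots> \<le> l * norm (R z) + l * norm (R z)"
      using norm_operator_resolvent_le[OF l, of "R z"] l by simp
    finally show ?thesis
      by (simp add: algebra_simps)
  qed
  have "norm (D (g - A u)) \<le> 2 * norm (g - A u)"
    using D_le[of "g - A u"] norm_resolvent_le[OF l, of "g - A u"] l by (simp add: field_simps)
  moreover have "norm (D (A u)) \<le> 2 * l * norm u"
  proof -
    have "norm (R (A u)) \<le> norm u"
      using norm_operator_resolvent_le[OF l, of u] by (simp add: resolvent_commute[OF l])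
    then have "l * (norm (R (A u)) + norm (R (A u))) \<le> l * (norm u + norm u)"
      using l by (intro mult_left_mono) auto
    then show ?thesis
      using D_le[of "A u"] by simp
  qed
  moreover have "g - R (R (A (A g))) = D (g - A u) + D (A u)"
    by (simp add: D flip: D_add)
  ultimately show ?thesis
    using norm_triangle_ineq[of "D (g - A u)" "D (A u)"] by simp
qed

text \<open>
  The vector \<open>w\<close> is a surrogate for \<open>A g\<close>: below it will be the image of \<open>g\<close> under the population
  operator, while \<open>A\<close> is the operator of a sample.
\<close>
lemma tikhonov_error:
  assumes "A (v - w) = 0"
  shows "norm (R (R (A v)) - g) \<le> norm (A g - w) / l + 2 * norm (g - A u) + 2 * l * norm u"
proof -
  have "A v = A (A g) - A (A g - w)"
    using assms by (simp add: linear_diff[OF linear])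
  then have "R (R (A v)) - g = - (R (R (A (A g - w)))) - (g - R (R (A (A g))))"
    by (simp add: linear_diff[OF linear_resolvent[OF l]] linear_diff[OF linear])
  then have "norm (R (R (A v)) - g)
      \<le> norm (R (R (A (A g - w)))) + norm (g - R (R (A (A g))))"
    by (metis norm_minus_cancel norm_triangle_ineq4)
  then show ?thesis
    using norm_resolvent2_operator_le[of "A g - w"] tikhonov_residual[of g u] by linarith
qed

end

end

text \<open>
  Expanding \<open>v = (B + l I)\<^sup>2 w\<close>, the mixed terms \<open>2 l A B w\<close> cancel in the difference. What remains
  contains \<open>A - B\<close> only at \<open>B w\<close> and at \<open>w\<close>, vectors that depend on \<open>B\<close> but not on \<open>A\<close>.
\<close>
lemma tikhonov_perturbation:
  fixes v :: "'h::{real_inner,complete_space}"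
  assumes A: "positive_operator A M" and B: "positive_operator B N" and l: "l > 0"
  defines "w \<equiv> reg_inverse B l (reg_inverse B l v)"
  shows "norm (reg_inverse A l (reg_inverse A l (A v)) - reg_inverse B l (reg_inverse B l (B v)))
    \<le> M / l\<^sup>2 * norm (A (B w) - B (B w)) + norm (A w - B w)"
proof -
  interpret A: positive_operator A M by (rule A)
  interpret B: positive_operator B N by (rule B)
  let ?R = "reg_inverse A l" and ?S = "reg_inverse B l"
  note linR = A.linear_resolvent[OF l]
  have R2: "?R (?R (A (A z) + (2 * l) *\<^sub>R A z + l\<^sup>2 *\<^sub>R z)) = z" for z
  proof -
    have "?R (A (A z) + (2 * l) *\<^sub>R A z + l\<^sup>2 *\<^sub>R z) = A z + l *\<^sub>R z"
      by (intro A.resolvent_eqI[OF l])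
        (simp add: linear_add[OF A.linear] linear_scale[OF A.linear] power2_eq_square
          algebra_simps flip: scaleR_add_left)
    then show ?thesis
      by (simp add: A.resolvent_eqI[OF l])
  qed
  have square: "B (B w + l *\<^sub>R w) + l *\<^sub>R (B w + l *\<^sub>R w) = v"
    by (simp add: w_def B.shift_resolvent[OF l])
  have v: "v = B (B w) + (2 * l) *\<^sub>R B w + l\<^sup>2 *\<^sub>R w"
    unfolding square[symmetric]
    by (simp add: linear_add[OF B.linear] linear_scale[OF B.linear] power2_eq_square
        algebra_simps flip: scaleR_add_left)
  have Bw: "?S (?S (B v)) = B w"
    by (simp add: w_def B.resolvent_commute[OF l])
  have "?R (?R (A v)) - B w
      = ?R (?R (A v)) - ?R (?R (A (A (B w)) + (2 * l) *\<^sub>R A (B w) + l\<^sup>2 *\<^sub>R B w))"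
    by (simp only: R2)
  also have "\<dots> = ?R (?R (A (B (B w) - A (B w)) + l\<^sup>2 *\<^sub>R (A w - B w)))"
    by (subst v) (simp add: linear_add[OF A.linear] linear_scale[OF A.linear]
        linear_diff[OF A.linear] algebra_simps flip: linear_diff[OF linR])
  finally have "?R (?R (A v)) - B w
      = ?R (?R (A (B (B w) - A (B w)))) + l\<^sup>2 *\<^sub>R ?R (?R (A w - B w))"
    by (simp add: linear_add[OF linR] linear_scale[OF linR])
  then have "norm (?R (?R (A v)) - B w)
      \<le> norm (?R (?R (A (B (B w) - A (B w))))) + l\<^sup>2 * norm (?R (?R (A w - B w)))"
    using norm_triangle_ineq[of "?R (?R (A (B (B w) - A (B w))))" "l\<^sup>2 *\<^sub>R ?R (?R (A w - B w))"]
    by simp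
  moreover have RR: "norm (?R (?R z)) \<le> norm z / l\<^sup>2" for z
  proof -
    have "norm (?R (?R z)) \<le> norm (?R z) / l"
      by (rule A.norm_resolvent_le[OF l])
    also have "\<dots> \<le> norm z / l / l"
      using l by (intro divide_right_mono A.norm_resolvent_le) auto
    finally show ?thesis
      by (simp add: power2_eq_square)
  qed
  moreover have "norm (A (B (B w) - A (B w))) / l\<^sup>2 \<le> M / l\<^sup>2 * norm (A (B w) - B (B w))"
    using divide_right_mono[OF A.bounded[of "B (B w) - A (B w)"], of "l\<^sup>2"]
    by (simp add: norm_minus_commute)
  moreover have "l\<^sup>2 * norm (?R (?R (A w - B w))) \<le> norm (A w - B w)"
    using RR[of "A w - B w"] l by (simp add: field_simps)
  ultimately show ?thesis
    unfolding Bw using RR[of "A (B (B w) - A (B w))"] by linarith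
qed

text \<open>
  The operators \<open>A i\<close> need to converge to \<open>W\<close> only pointwise on the set \<open>U\<close>. In the application \<open>U\<close> is a
  sequence, so that countably many almost sure statements suffice.
\<close>
lemma tikhonov_tendsto:
  fixes A :: "'i \<Rightarrow> 'h::{real_inner,complete_space} \<Rightarrow> 'h"
  assumes pos: "eventually (\<lambda>i. positive_operator (A i) M \<and> l i > 0 \<and> A i (v - W g) = 0) F"
    and l: "(l \<longlongrightarrow> 0) F"
    and rate: "((\<lambda>i. norm (A i g - W g) / l i) \<longlongrightarrow> 0) F"
    and g: "g \<in> closure (W ` U)"
    and strong: "\<And>u. u \<in> U \<Longrightarrow> ((\<lambda>i. A i u) \<longlongrightarrow> W u) F"
  shows "((\<lambda>i. (reg_inverse (A i) (l i) ^^ 2) (A i v)) \<longlongrightarrow> g) F"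
proof (rule tendstoI)
  fix e :: real
  assume e: "e > 0"
  obtain u where u: "u \<in> U" "norm (W u - g) < e / 4"
    using g e unfolding closure_approachable dist_norm
    by (metis (no_types, lifting) divide_pos_pos imageE zero_less_numeral)
  define err where "err i = norm (A i g - W g) / l i + 2 * norm (g - A i u) + 2 * l i * norm u" for i
  have "(err \<longlongrightarrow> 0 + 2 * norm (g - W u) + 2 * 0 * norm u) F"
    unfolding err_def by (intro tendsto_intros rate l strong u)
  moreover have "0 + 2 * norm (g - W u) + 2 * 0 * norm u < e"
    using u(2) e by (simp add: norm_minus_commute)
  ultimately have "eventually (\<lambda>i. err i < e) F"
    by (rule order_tendstoD)
  with pos show "eventually (\<lambda>i. dist ((reg_inverse (A i) (l i) ^^ 2) (A i v)) g < e) F"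
  proof eventually_elim
    case (elim i)
    interpret positive_operator "A i" M
      using elim by simp
    show ?case
      using elim tikhonov_error[of "l i" v "W g" g u]
      by (simp add: dist_norm err_def numeral_2_eq_2)
  qed
qed

section \<open>Concentration of sums of Hilbert space valued random vectors\<close>

text \<open>
  The power series of \<open>cosh (sqrt x)\<close> is \<open>\<Sum> x\<^sup>j / (2 j)!\<close>, a combination of convex functions on
  \<open>x \<ge> 0\<close> with nonnegative coefficients.
\<close>
lemma cosh_sqrt_convex:
  fixes p q t :: real
  assumes "0 \<le> p" "0 \<le> q" "0 \<le> t" "t \<le> 1"
  shows "cosh (sqrt ((1 - t) * p + t * q)) \<le> (1 - t) * cosh (sqrt p) + t * cosh (sqrt q)"
proof -
  define c where "c n x = (if even n then sqrt x ^ n /\<^sub>R fact n else 0)" for n and x :: real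
  have c: "(\<lambda>n. c n x) sums cosh (sqrt x)" for x
    unfolding c_def by (rule cosh_converges)
  have chord: "(\<lambda>n. (1 - t) * c n p + t * c n q) sums ((1 - t) * cosh (sqrt p) + t * cosh (sqrt q))"
    by (intro sums_add sums_mult c)
  have "c n ((1 - t) * p + t * q) \<le> (1 - t) * c n p + t * c n q" for n
  proof (cases "even n")
    case True
    then obtain j where n: "n = 2 * j" by blast
    have c_even: "c n x = x ^ j / fact n" if "0 \<le> x" for x
      using that by (simp add: c_def n power_mult divide_inverse)
    have "convex_on {0..} (\<lambda>x::real. x ^ j)"
      by (cases "even j") (auto intro: convex_power_odd convex_on_subset[OF convex_power_even])
    then have "((1 - t) * p + t * q) ^ j \<le> (1 - t) * p ^ j + t * q ^ j"
      using convex_onD[of "{0..}" "\<lambda>x. x ^ j" t p q] assms by simp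
    then have "((1 - t) * p + t * q) ^ j / fact n \<le> ((1 - t) * p ^ j + t * q ^ j) / fact n"
      by (intro divide_right_mono) auto
    moreover have "0 \<le> (1 - t) * p + t * q"
      using assms by simp
    ultimately show ?thesis
      using assms by (simp add: c_even add_divide_distrib)
  qed (simp add: c_def)
  then show ?thesis
    by (rule sums_le[OF _ c chord])
qed

text \<open>
  The step that replaces the scalar Hoeffding lemma. If \<open>\<parallel>y\<parallel> \<le> c\<close>, then \<open>\<parallel>x + y\<parallel>\<^sup>2\<close> is at most
  \<open>\<parallel>x\<parallel>\<^sup>2 + c\<^sup>2 + 2 (x \<bullet> y)\<close>, a point of the interval from \<open>(\<parallel>x\<parallel> - c)\<^sup>2\<close> to \<open>(\<parallel>x\<parallel> + c)\<^sup>2\<close> that is affine in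
  \<open>x \<bullet> y\<close>. The chord of the convex function \<open>cosh (s sqrt _)\<close> over this interval gives the bound. Its
  slope \<open>b\<close> does not depend on \<open>y\<close>, so the last term has mean zero when \<open>y\<close> is a centred random vector.
\<close>
lemma cosh_norm_add_le:
  fixes x :: "'h::real_inner"
  assumes c: "0 \<le> c" and s: "0 \<le> s"
  obtains b where "\<And>y. norm y \<le> c \<Longrightarrow>
    cosh (s * norm (x + y)) \<le> cosh (s * norm x) * cosh (s * c) + b * (x \<bullet> y)"
proof -
  define a where "a = norm x"
  define b where "b = sinh (s * a) * sinh (s * c) / (a * c)"
  have a: "0 \<le> a"
    by (simp add: a_def)
  have "cosh (s * norm (x + y)) \<le> cosh (s * a) * cosh (s * c) + b * (x \<bullet> y)"
    if y: "norm y \<le> c" for y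
  proof -
    \<comment> \<open>The position of \<open>a\<^sup>2 + c\<^sup>2 + 2 (x \<bullet> y)\<close> between \<open>(a - c)\<^sup>2\<close> and \<open>(a + c)\<^sup>2\<close>; if \<open>a * c = 0\<close>,
      then the interval is a point and the value \<open>1 / 2\<close> does as well as any other.\<close>
    define t where "t = (1 + (x \<bullet> y) / (a * c)) / 2"
    define p q where "p = (s * (a - c))\<^sup>2" and "q = (s * (a + c))\<^sup>2"
    have xy: "\<bar>x \<bullet> y\<bar> \<le> a * c"
      using Cauchy_Schwarz_ineq2[of x y] mult_left_mono[OF y, of a] a by (simp add: a_def)
    then have "\<bar>(x \<bullet> y) / (a * c)\<bar> \<le> 1"
      using a c by (cases "a * c = 0") (auto simp: abs_mult divide_le_eq)
    then have t: "0 \<le> t" "t \<le> 1"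
      using abs_le_D1[of "(x \<bullet> y) / (a * c)" 1] abs_le_D2[of "(x \<bullet> y) / (a * c)" 1]
      unfolding t_def by simp_all
    have "(norm (x + y))\<^sup>2 = a\<^sup>2 + 2 * (x \<bullet> y) + (norm y)\<^sup>2"
      using dot_norm[of x y] by (simp add: a_def field_simps)
    also have "\<dots> \<le> a\<^sup>2 + 2 * (x \<bullet> y) + c\<^sup>2"
      using y by (simp add: power_mono)
    finally have "(s * norm (x + y))\<^sup>2 \<le> s\<^sup>2 * (a\<^sup>2 + 2 * (x \<bullet> y) + c\<^sup>2)"
      by (simp add: power_mult_distrib mult_left_mono)
    also have "\<dots> = (1 - t) * p + t * q"
    proof -
      have "4 * a * c * t = 2 * a * c + 2 * (x \<bullet> y)"
        using xy by (auto simp: t_def field_simps)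
      then have "a\<^sup>2 + 2 * (x \<bullet> y) + c\<^sup>2 = (a - c)\<^sup>2 + t * ((a + c)\<^sup>2 - (a - c)\<^sup>2)"
        by (simp add: power2_eq_square algebra_simps)
      then show ?thesis
        by (simp only: p_def q_def power_mult_distrib) (simp add: algebra_simps)
    qed
    finally have "s * norm (x + y) \<le> sqrt ((1 - t) * p + t * q)"
      by (rule real_le_rsqrt)
    then have "cosh (s * norm (x + y)) \<le> cosh (sqrt ((1 - t) * p + t * q))"
      using s t by (subst cosh_real_nonneg_le_iff) (auto simp: p_def q_def)
    also have "\<dots> \<le> (1 - t) * cosh (sqrt p) + t * cosh (sqrt q)"
      using t by (intro cosh_sqrt_convex) (auto simp: p_def q_def)
    also have "\<dots> = (1 - t) * cosh (s * a - s * c) + t * cosh (s * a + s * c)"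
      by (simp add: p_def q_def right_diff_distrib distrib_left)
    also have "\<dots> = cosh (s * a) * cosh (s * c) + (2 * t - 1) * (sinh (s * a) * sinh (s * c))"
      by (simp add: cosh_add cosh_diff algebra_simps)
    also have "(2 * t - 1) * (sinh (s * a) * sinh (s * c)) = b * (x \<bullet> y)"
      by (simp add: t_def b_def add_divide_distrib)
    finally show ?thesis .
  qed
  then show ?thesis
    by (intro that[of b]) (simp add: a_def)
qed

text \<open>Comparison of the power series term by term, using \<open>2\<^sup>j j! \<le> (2 j)!\<close>.\<close>
lemma cosh_le_exp_half_square: "cosh x \<le> exp (x\<^sup>2 / 2)" for x :: real
proof -
  define c where "c n = (if even n then x ^ n /\<^sub>R fact n else 0)" for n
  have fact_ge: "2 ^ j * fact j \<le> (fact (2 * j) :: real)" for j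
  proof (induction j)
    case (Suc j)
    have "2 ^ Suc j * fact (Suc j) = (2 * real (Suc j)) * (2 ^ j * fact j)"
      by simp
    also have "\<dots> \<le> (2 * real (Suc j)) * fact (2 * j)"
      by (intro mult_left_mono Suc.IH) auto
    also have "\<dots> \<le> (2 * real (Suc j)) * (real (2 * j + 1) * fact (2 * j))"
      by (intro mult_left_mono mult_left_mono[of 1, simplified]) auto
    also have "\<dots> = fact (Suc (Suc (2 * j)))"
      unfolding fact_Suc by simp
    also have "Suc (Suc (2 * j)) = 2 * Suc j"
      by simp
    finally show ?case .
  qed simp
  have "c sums cosh x"
    unfolding c_def by (rule cosh_converges)
  then have cosh_even: "(\<lambda>j. c (2 * j)) sums cosh x"
    by (subst sums_mono_reindex[where g = "\<lambda>j. 2 * j"]) (auto simp: strict_mono_def c_def)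
  have "c (2 * j) \<le> (x\<^sup>2 / 2) ^ j /\<^sub>R fact j" for j
  proof -
    have "(x\<^sup>2) ^ j / fact (2 * j) \<le> (x\<^sup>2) ^ j / (2 ^ j * fact j)"
      using fact_ge[of j] by (intro divide_left_mono) auto
    moreover have "c (2 * j) = (x\<^sup>2) ^ j / fact (2 * j)"
      by (simp add: c_def power_mult divide_inverse_commute)
    moreover have "(x\<^sup>2 / 2) ^ j /\<^sub>R fact j = (x\<^sup>2) ^ j / (2 ^ j * fact j)"
      by (simp add: power_divide field_simps)
    ultimately show ?thesis
      by simp
  qed
  then show ?thesis
    by (rule sums_le[OF _ cosh_even exp_converges])
qed

lemma borel_measurable_cosh [measurable]: "(cosh :: real \<Rightarrow> real) \<in> borel_measurable borel"
  by (intro borel_measurable_continuous_onI continuous_intros)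

context prob_space
begin

text \<open>
  Adding one independent centred summand multiplies the mean of \<open>cosh (s \<parallel>S\<parallel>)\<close> by at most \<open>cosh (s c)\<close>:
  integrate the chord bound over the new summand with the previous partial sum held fixed. The
  mean is expressed through inner products with fixed vectors, because the Bochner integral of a
  bounded random vector may fail to exist when the space is not complete.
\<close>
lemma nn_expectation_cosh_sum_le:
  fixes Y :: "'i \<Rightarrow> 'a \<Rightarrow> 'h::{real_inner,second_countable_topology}"
  assumes I: "finite I"
    and indep: "indep_vars (\<lambda>_. borel) Y I"
    and bnd: "\<And>i \<omega>. i \<in> I \<Longrightarrow> \<omega> \<in> space M \<Longrightarrow> norm (Y i \<omega>) \<le> c"
    and mean: "\<And>i v. i \<in> I \<Longrightarrow> expectation (\<lambda>\<omega>. v \<bullet> Y i \<omega>) = 0"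
    and s: "0 \<le> s"
  shows "(\<integral>\<^sup>+\<omega>. ennreal (cosh (s * norm (\<Sum>i\<in>I. Y i \<omega>))) \<partial>M) \<le> ennreal (cosh (s * c) ^ card I)"
  using I indep bnd mean
proof (induction I rule: finite_induct)
  case empty
  then show ?case
    by (simp add: emeasure_space_1)
next
  case (insert j J)
  define S where "S \<omega> = (\<Sum>i\<in>J. Y i \<omega>)" for \<omega>
  have Y: "Y i \<in> borel_measurable M" if "i \<in> insert j J" for i
    using insert.prems(1) that by (auto simp: indep_vars_def)
  then have S: "S \<in> borel_measurable M"
    unfolding S_def by (intro borel_measurable_sum) auto
  have bj: "norm (Y j \<omega>) \<le> c" if "\<omega> \<in> space M" for \<omega>
    using insert.prems(2) that by simp
  have "indep_var (PiM J (\<lambda>_. borel)) (\<lambda>\<omega>. restrict (\<lambda>i. Y i \<omega>) J)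
      (PiM {j} (\<lambda>_. borel)) (\<lambda>\<omega>. restrict (\<lambda>i. Y i \<omega>) {j})"
    using insert.hyps insert.prems(1) by (intro indep_var_restrict[of _ _ "insert j J"]) auto
  then have "indep_var borel ((\<lambda>f. \<Sum>i\<in>J. f i) \<circ> (\<lambda>\<omega>. restrict (\<lambda>i. Y i \<omega>) J))
      borel ((\<lambda>f. f j) \<circ> (\<lambda>\<omega>. restrict (\<lambda>i. Y i \<omega>) {j}))"
    by (rule indep_var_compose) auto
  moreover have "(\<lambda>f. \<Sum>i\<in>J. f i) \<circ> (\<lambda>\<omega>. restrict (\<lambda>i. Y i \<omega>) J) = S"
    by (auto simp: S_def)
  moreover have "(\<lambda>f. f j) \<circ> (\<lambda>\<omega>. restrict (\<lambda>i. Y i \<omega>) {j}) = Y j"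
    by auto
  ultimately have pair: "distr M borel S \<Otimes>\<^sub>M distr M borel (Y j)
      = distr M (borel \<Otimes>\<^sub>M borel) (\<lambda>\<omega>. (S \<omega>, Y j \<omega>))"
    by (simp add: indep_var_distribution_eq)
  interpret Yj: prob_space "distr M borel (Y j)"
    using Y by (intro prob_space_distr) auto
  have step: "(\<integral>\<^sup>+\<omega>. ennreal (cosh (s * norm (v + Y j \<omega>))) \<partial>M)
      \<le> ennreal (cosh (s * norm v)) * ennreal (cosh (s * c))" for v
  proof -
    have "0 \<le> c"
      using not_empty bj norm_ge_zero order_trans by blast
    then obtain b where b: "\<And>y. norm y \<le> c \<Longrightarrow>
        cosh (s * norm (v + y)) \<le> cosh (s * norm v) * cosh (s * c) + b * (v \<bullet> y)"
      using cosh_norm_add_le[OF _ s] by metis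
    have "norm (v \<bullet> Y j \<omega>) \<le> norm v * c" if "\<omega> \<in> space M" for \<omega>
      using Cauchy_Schwarz_ineq2[of v "Y j \<omega>"] mult_left_mono[OF bj[OF that], of "norm v"] by simp
    then have int: "integrable M (\<lambda>\<omega>. v \<bullet> Y j \<omega>)"
      using Y by (intro integrable_const_bound[where B = "norm v * c"] AE_I2) auto
    then have int': "integrable M (\<lambda>\<omega>. cosh (s * norm v) * cosh (s * c) + b * (v \<bullet> Y j \<omega>))"
      by auto
    have "(\<integral>\<^sup>+\<omega>. ennreal (cosh (s * norm (v + Y j \<omega>))) \<partial>M)
        \<le> (\<integral>\<^sup>+\<omega>. ennreal (cosh (s * norm v) * cosh (s * c) + b * (v \<bullet> Y j \<omega>)) \<partial>M)"
      using b bj by (intro nn_integral_mono ennreal_leI) auto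
    also have "\<dots> = ennreal (expectation (\<lambda>\<omega>. cosh (s * norm v) * cosh (s * c) + b * (v \<bullet> Y j \<omega>)))"
      using int' b bj by (intro nn_integral_eq_integral)
        (auto intro!: AE_I2 order_trans[OF _ b])
    also have "\<dots> = ennreal (cosh (s * norm v) * cosh (s * c))"
      using int insert.prems(3)[of j v] by (simp add: prob_space)
    finally show ?thesis
      by (simp add: ennreal_mult)
  qed
  have "(\<integral>\<^sup>+\<omega>. ennreal (cosh (s * norm (\<Sum>i\<in>insert j J. Y i \<omega>))) \<partial>M)
      = (\<integral>\<^sup>+\<omega>. ennreal (cosh (s * norm (S \<omega> + Y j \<omega>))) \<partial>M)"
    using insert.hyps by (simp add: S_def add.commute)
  also have "\<dots> = (\<integral>\<^sup>+z. ennreal (cosh (s * norm (fst z + snd z)))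
      \<partial>distr M (borel \<Otimes>\<^sub>M borel) (\<lambda>\<omega>. (S \<omega>, Y j \<omega>)))"
    using S Y by (subst nn_integral_distr) auto
  also have "\<dots> = (\<integral>\<^sup>+v. \<integral>\<^sup>+y. ennreal (cosh (s * norm (v + y))) \<partial>distr M borel (Y j) \<partial>distr M borel S)"
    unfolding pair[symmetric] by (subst Yj.nn_integral_fst[symmetric]) auto
  also have "\<dots> = (\<integral>\<^sup>+\<omega>'. \<integral>\<^sup>+\<omega>. ennreal (cosh (s * norm (S \<omega>' + Y j \<omega>))) \<partial>M \<partial>M)"
    using S Y by (simp add: nn_integral_distr)
  also have "\<dots> \<le> (\<integral>\<^sup>+\<omega>. ennreal (cosh (s * norm (S \<omega>))) * ennreal (cosh (s * c)) \<partial>M)"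
    by (intro nn_integral_mono step)
  also have "\<dots> = (\<integral>\<^sup>+\<omega>. ennreal (cosh (s * norm (S \<omega>))) \<partial>M) * ennreal (cosh (s * c))"
    using S by (intro nn_integral_multc) auto
  also have "\<dots> \<le> ennreal (cosh (s * c) ^ card J) * ennreal (cosh (s * c))"
    unfolding S_def using insert.prems indep_vars_subset[OF insert.prems(1) subset_insertI]
    by (intro mult_right_mono insert.IH) auto
  also have "\<dots> = ennreal (cosh (s * c) ^ card (insert j J))"
    using insert.hyps by (simp add: ennreal_mult'' mult.commute)
  finally show ?case .
qed

text \<open>
  Markov's inequality for \<open>cosh (s \<parallel>S\<parallel>) \<ge> exp (s \<parallel>S\<parallel>) / 2\<close> yields the tail bound
  \<open>2 exp (- t\<^sup>2 / (2 n c\<^sup>2))\<close>, as for real summands, without any dependence on the dimension. It is stated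
  here after solving for the threshold \<open>t\<close> at a given failure probability \<open>\<delta>\<close>.
\<close>
theorem hilbert_hoeffding:
  fixes Y :: "'i \<Rightarrow> 'a \<Rightarrow> 'h::{real_inner,second_countable_topology}"
  assumes I: "finite I"
    and indep: "indep_vars (\<lambda>_. borel) Y I"
    and bnd: "\<And>i \<omega>. i \<in> I \<Longrightarrow> \<omega> \<in> space M \<Longrightarrow> norm (Y i \<omega>) \<le> c"
    and mean: "\<And>i v. i \<in> I \<Longrightarrow> expectation (\<lambda>\<omega>. v \<bullet> Y i \<omega>) = 0"
    and \<delta>: "0 < \<delta>" "\<delta> \<le> 1"
  shows "prob {\<omega> \<in> space M. c * sqrt (2 * card I * ln (2 / \<delta>)) < norm (\<Sum>i\<in>I. Y i \<omega>)} \<le> \<delta>"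
    (is "prob ?bad \<le> \<delta>")
proof (cases "I = {} \<or> c \<le> 0")
  case True
  have "?bad = {}"
  proof (cases "I = {}")
    case False
    then have "c = 0" if "\<omega> \<in> space M" for \<omega>
      using True bnd[OF _ that] norm_ge_zero[of "Y _ \<omega>"] by (metis all_not_in_conv dual_order.trans
          order_antisym)
    then have "norm (\<Sum>i\<in>I. Y i \<omega>) = 0" if "\<omega> \<in> space M" for \<omega>
      using bnd[OF _ that] that by (simp add: sum.neutral)
    then show ?thesis
      using \<open>\<And>\<omega>. \<omega> \<in> space M \<Longrightarrow> c = 0\<close> by auto
  qed simp
  then show ?thesis
    using \<delta> by (simp only: measure_empty)
next
  case False
  then have c: "c > 0" and n: "card I > 0"
    using I by (auto simp: card_gt_0_iff)
  define L where "L = ln (2 / \<delta>)"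
  define t where "t = c * sqrt (2 * card I * L)"
  \<comment> \<open>The minimiser of \<open>card I * (s * c)\<^sup>2 / 2 - s * t\<close>.\<close>
  define s where "s = t / (card I * c\<^sup>2)"
  have L: "L > 0"
    using \<delta> by (simp add: L_def)
  have t: "t > 0" and s: "s > 0"
    using c n L by (auto simp: t_def s_def)
  have st: "s * t = 2 * L"
    using c n L by (simp add: s_def t_def power2_eq_square)
  have sc: "card I * ((s * c)\<^sup>2 / 2) = L"
    using c n L by (simp add: s_def t_def power_mult_distrib power_divide) 
      (simp add: power2_eq_square power4_eq_xxxx field_simps)
  define S where "S \<omega> = (\<Sum>i\<in>I. Y i \<omega>)" for \<omega>
  have "Y i \<in> borel_measurable M" if "i \<in> I" for i
    using indep that by (auto simp: indep_vars_def)
  then have S: "S \<in> borel_measurable M"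
    unfolding S_def by (intro borel_measurable_sum) auto
  have "emeasure M ?bad \<le> emeasure M {\<omega> \<in> space M. 1 \<le> ennreal (exp (- (s * t)) * 2) * ennreal (cosh (s * norm (S \<omega>)))}"
  proof (intro emeasure_mono subsetI CollectI conjI)
    fix \<omega>
    assume "\<omega> \<in> ?bad"
    then have "t < norm (S \<omega>)" and \<omega>: "\<omega> \<in> space M"
      by (auto simp: t_def S_def L_def)
    then have "exp (s * t) \<le> exp (s * norm (S \<omega>))"
      using s by simp
    also have "\<dots> \<le> 2 * cosh (s * norm (S \<omega>))"
      by (simp add: cosh_def)
    finally have "1 \<le> exp (- (s * t)) * 2 * cosh (s * norm (S \<omega>))"
      by (simp add: exp_minus field_simps)
    then show "1 \<le> ennreal (exp (- (s * t)) * 2) * ennreal (cosh (s * norm (S \<omega>)))"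
      by (simp flip: ennreal_mult)
    show "\<omega> \<in> space M" by (rule \<omega>)
  qed (use S in measurable)
  also have "\<dots> \<le> ennreal (exp (- (s * t)) * 2) *
      (\<integral>\<^sup>+\<omega>. ennreal (cosh (s * norm (S \<omega>))) * indicator (space M) \<omega> \<partial>M)"
    using S by (intro order_trans[OF _ nn_integral_Markov_inequality]) auto
  also have "(\<integral>\<^sup>+\<omega>. ennreal (cosh (s * norm (S \<omega>))) * indicator (space M) \<omega> \<partial>M)
      = (\<integral>\<^sup>+\<omega>. ennreal (cosh (s * norm (S \<omega>))) \<partial>M)"
    by (intro nn_integral_cong) auto
  also have "\<dots> \<le> ennreal (cosh (s * c) ^ card I)"
    unfolding S_def using s by (intro nn_expectation_cosh_sum_le I indep bnd mean) auto
  also have "cosh (s * c) ^ card I \<le> exp ((s * c)\<^sup>2 / 2) ^ card I"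
    by (intro power_mono cosh_le_exp_half_square) auto
  also have "\<dots> = exp L"
    using sc by (simp flip: exp_of_nat_mult)
  finally have "emeasure M ?bad \<le> ennreal (exp (- (s * t)) * 2) * ennreal (exp L)"
    by (simp add: mult_left_mono ennreal_leI)
  also have "\<dots> = ennreal \<delta>"
    using \<delta> by (simp add: st L_def exp_minus exp_double power2_eq_square field_simps flip: ennreal_mult)
  finally show ?thesis
    using \<delta> by (simp add: emeasure_eq_measure)
qed

end

section \<open>Gramians of a bounded feature map\<close>

text \<open>
  A type of sort \<open>{real_normed_vector, complete_space}\<close> need not belong to the class \<open>banach\<close>, although
  the two have the same axioms. So integrability is obtained here from the definition: the integrals
  of approximating simple functions form a Cauchy sequence, by dominated convergence.
\<close>
lemma (in finite_measure) integrable_bounded_complete: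
  fixes f :: "'a \<Rightarrow> 'h::{real_normed_vector,complete_space,second_countable_topology}"
  assumes f [measurable]: "f \<in> borel_measurable M"
    and bnd: "\<And>x. x \<in> space M \<Longrightarrow> norm (f x) \<le> B"
  shows "integrable M f"
proof -
  obtain s where s: "\<And>i. simple_function M (s i)"
    and lim: "\<And>x. x \<in> space M \<Longrightarrow> (\<lambda>i. s i x) \<longlonglongrightarrow> f x"
    and le: "\<And>i x. x \<in> space M \<Longrightarrow> dist (s i x) 0 \<le> 2 * dist (f x) 0"
    using borel_measurable_implies_sequence_metric[OF f, of 0] by metis
  have [measurable]: "s i \<in> borel_measurable M" for i
    using s by (rule borel_measurable_simple_function)
  have s_int: "Bochner_Integration.simple_bochner_integrable M (s i)" for i
    by (rule Bochner_Integration.simple_bochner_integrable.intros[OF s]) simp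
  have norm_s: "norm (s i x) \<le> 2 * B" if "x \<in> space M" for i x
    using le[OF that, of i] bnd[OF that] by simp
  define e where "e i = (\<integral>\<^sup>+x. norm (f x - s i x) \<partial>M)" for i
  have e: "e \<longlonglongrightarrow> 0"
    unfolding e_def
  proof (rule nn_integral_dominated_convergence_norm[where w = "\<lambda>_. 2 * B"])
    show "(\<integral>\<^sup>+x. ennreal (2 * B) \<partial>M) < \<infinity>"
      by (simp add: ennreal_mult_eq_top_iff less_top[symmetric])
  qed (auto simp: norm_s lim)
  define c where "c i = Bochner_Integration.simple_bochner_integral M (s i)" for i
  have c_le: "ennreal (norm (c i - c j)) \<le> e i + e j" for i j
    unfolding c_def e_def using s_int f by (intro simple_bochner_integral_bounded)
  have "Cauchy c"
  proof (rule metric_CauchyI)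
    fix r :: real
    assume r: "r > 0"
    have "eventually (\<lambda>i. e i < ennreal (r / 2)) sequentially"
      using e r by (intro order_tendstoD(2)) auto
    then obtain N where N: "\<And>i. N \<le> i \<Longrightarrow> e i < ennreal (r / 2)"
      unfolding eventually_sequentially by blast
    have "dist (c i) (c j) < r" if "N \<le> i" "N \<le> j" for i j
    proof -
      have "ennreal (norm (c i - c j)) < ennreal (r / 2) + ennreal (r / 2)"
        using c_le[of i j] add_strict_mono[OF N[OF that(1)] N[OF that(2)]] by (rule le_less_trans)
      also have "\<dots> = ennreal r"
        using r by (simp flip: ennreal_plus)
      finally show ?thesis
        by (simp add: dist_norm ennreal_less_iff)
    qed
    then show "\<exists>N. \<forall>i\<ge>N. \<forall>j\<ge>N. dist (c i) (c j) < r"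
      by blast
  qed
  then obtain a where "c \<longlonglongrightarrow> a"
    unfolding Cauchy_convergent_iff convergent_def by blast
  then have "has_bochner_integral M f a"
    using f s_int e unfolding c_def e_def by (intro has_bochner_integral.intros)
  then show ?thesis
    by (rule integrable.intros)
qed

lemma norm_rank_one_le:
  fixes a h :: "'h::real_inner"
  assumes "norm a \<le> \<kappa>"
  shows "norm ((h \<bullet> a) *\<^sub>R a) \<le> \<kappa>\<^sup>2 * norm h"
proof -
  have "0 \<le> \<kappa>"
    using assms norm_ge_zero order_trans by blast
  have "norm ((h \<bullet> a) *\<^sub>R a) \<le> (norm h * norm a) * norm a"
    using Cauchy_Schwarz_ineq2[of h a] by (simp add: mult_right_mono)
  also have "\<dots> \<le> (norm h * \<kappa>) * \<kappa>"
    using assms \<open>0 \<le> \<kappa>\<close> by (intro mult_mono) auto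
  finally show ?thesis
    by (simp add: power2_eq_square mult_ac)
qed

lemma positive_operator_emp_gramian:
  fixes k :: "'x \<Rightarrow> 'h::{real_inner,complete_space}"
  assumes bnd: "\<And>i. 1 \<le> i \<Longrightarrow> norm (k (xs i)) \<le> \<kappa>"
  shows "positive_operator (emp_gramian k xs m) (\<kappa>\<^sup>2)"
proof (rule positive_operator.intro)
  show "linear (emp_gramian k xs m)"
    by (rule linearI) (simp_all add: emp_gramian_def inner_add_left scaleR_add_left sum.distrib
        scaleR_add_right scaleR_sum_right mult_ac)
  show "emp_gramian k xs m x \<bullet> y = x \<bullet> emp_gramian k xs m y" for x y
    by (simp add: emp_gramian_def inner_sum_left inner_sum_right inner_commute[of _ y] mult_ac)
  show "0 \<le> emp_gramian k xs m x \<bullet> x" for x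
    by (simp add: emp_gramian_def inner_sum_left inner_commute[of "k _" x] sum_nonneg)
  show "norm (emp_gramian k xs m x) \<le> \<kappa>\<^sup>2 * norm x" for x
  proof (cases "m = 0")
    case False
    have "norm (\<Sum>i=1..m. (x \<bullet> k (xs i)) *\<^sub>R k (xs i)) \<le> (\<Sum>i=1..m. \<kappa>\<^sup>2 * norm x)"
      using bnd by (intro sum_norm_le norm_rank_one_le) auto
    then show ?thesis
      using False by (simp add: emp_gramian_def field_simps)
  qed (simp add: emp_gramian_def)
qed simp

locale bounded_feature_map = prob_space \<mu>
  for \<mu> :: "'x measure" +
  fixes k :: "'x \<Rightarrow> 'h::{real_inner,complete_space,second_countable_topology}" and \<kappa> :: real
  assumes feature_measurable [measurable]: "k \<in> borel_measurable \<mu>"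
    and feature_bounded: "x \<in> space \<mu> \<Longrightarrow> norm (k x) \<le> \<kappa>"
begin

abbreviation "W \<equiv> gramian \<mu> k"

lemma bound_nonneg: "0 \<le> \<kappa>"
  using not_empty feature_bounded norm_ge_zero order_trans by blast

lemma integrable_rank_one: "integrable \<mu> (\<lambda>x. (h \<bullet> k x) *\<^sub>R k x)"
  using norm_rank_one_le[OF feature_bounded]
  by (intro integrable_bounded_complete[where B = "\<kappa>\<^sup>2 * norm h"]) auto

lemma integrable_feature_product: "integrable \<mu> (\<lambda>x. (h \<bullet> k x) * (k x \<bullet> u))"
  using integrable_inner_left[of u, OF integrable_rank_one[of h]] by simp

lemma gramian_inner: "W h \<bullet> u = (\<integral>x. (h \<bullet> k x) * (k x \<bullet> u) \<partial>\<mu>)"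
  unfolding gramian_def by (subst integral_inner_left[symmetric]) (simp_all add: integrable_rank_one)

lemma positive_operator_gramian: "positive_operator W (\<kappa>\<^sup>2)"
proof (rule positive_operator.intro)
  show "linear W"
  proof (rule linearI; rule vector_eq_rdot[THEN iffD1, rule_format])
    fix a b z :: 'h and c :: real
    show "W (a + b) \<bullet> z = (W a + W b) \<bullet> z"
      using integrable_feature_product
      by (simp add: gramian_inner inner_add_left distrib_right)
    show "W (c *\<^sub>R a) \<bullet> z = (c *\<^sub>R W a) \<bullet> z"
      by (simp add: gramian_inner mult.assoc)
  qed
  show "W x \<bullet> y = x \<bullet> W y" for x y
    unfolding inner_commute[of x] gramian_inner
    by (intro Bochner_Integration.integral_cong) (simp_all add: inner_commute mult.commute)
  show "0 \<le> W x \<bullet> x" for x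
    unfolding gramian_inner by (simp add: inner_commute[of _ x])
  show "norm (W x) \<le> \<kappa>\<^sup>2 * norm x" for x
  proof -
    have "(norm (W x))\<^sup>2 = (\<integral>z. (x \<bullet> k z) *\<^sub>R k z \<bullet> W x \<partial>\<mu>)"
      by (simp add: power2_norm_eq_inner gramian_inner)
    also have "\<dots> \<le> \<kappa>\<^sup>2 * norm x * norm (W x)"
    proof (intro integral_le_const AE_I2)
      show "integrable \<mu> (\<lambda>z. (x \<bullet> k z) *\<^sub>R k z \<bullet> W x)"
        using integrable_feature_product by simp
      fix z
      assume "z \<in> space \<mu>"
      then have "norm ((x \<bullet> k z) *\<^sub>R k z) \<le> \<kappa>\<^sup>2 * norm x"
        by (intro norm_rank_one_le feature_bounded)
      then have "norm ((x \<bullet> k z) *\<^sub>R k z) * norm (W x) \<le> \<kappa>\<^sup>2 * norm x * norm (W x)"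
        by (intro mult_right_mono) auto
      then show "(x \<bullet> k z) *\<^sub>R k z \<bullet> W x \<le> \<kappa>\<^sup>2 * norm x * norm (W x)"
        using norm_cauchy_schwarz[of "(x \<bullet> k z) *\<^sub>R k z" "W x"] by (rule order_trans[rotated])
    qed
    finally show ?thesis
      by (cases "norm (W x) = 0") (simp_all add: power2_eq_square)
  qed
qed simp

text \<open>Integrating \<open>(q \<bullet> k x)\<^sup>2\<close> gives \<open>W q \<bullet> q = 0\<close>.\<close>
lemma feature_orthogonal_kernel:
  assumes "W q = 0"
  shows "AE x in \<mu>. k x \<bullet> q = 0"
proof -
  have "(\<integral>x. (q \<bullet> k x) * (k x \<bullet> q) \<partial>\<mu>) = 0"
    using assms by (simp flip: gramian_inner)
  then have "AE x in \<mu>. (q \<bullet> k x) * (k x \<bullet> q) = 0"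
    using integrable_feature_product[of q q]
    by (subst (asm) integral_nonneg_eq_0_iff_AE) (auto simp: inner_commute[of q])
  then show ?thesis
    by (auto simp: inner_commute)
qed

end

section \<open>Gramians of a random sample\<close>

locale feature_sample = bounded_feature_map \<mu> k \<kappa> + P: prob_space P
  for \<mu> :: "'x measure" and k :: "'x \<Rightarrow> 'h::{real_inner,complete_space,second_countable_topology}"
    and \<kappa> :: real and P :: "'w measure" +
  fixes \<xi> :: "nat \<Rightarrow> 'w \<Rightarrow> 'x"
  assumes sample_measurable: "1 \<le> i \<Longrightarrow> \<xi> i \<in> measurable P \<mu>"
    and sample_distr: "1 \<le> i \<Longrightarrow> distr P \<mu> (\<xi> i) = \<mu>"
    and sample_indep: "P.indep_vars (\<lambda>_. \<mu>) \<xi> {1..}"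
begin

abbreviation "Wm m \<omega> \<equiv> emp_gramian k (\<lambda>i. \<xi> i \<omega>) m"

lemma sample_bounded: "1 \<le> i \<Longrightarrow> \<omega> \<in> space P \<Longrightarrow> norm (k (\<xi> i \<omega>)) \<le> \<kappa>"
  using measurable_space[OF sample_measurable] feature_bounded by blast

lemma positive_operator_sample: "\<omega> \<in> space P \<Longrightarrow> positive_operator (Wm m \<omega>) (\<kappa>\<^sup>2)"
  by (intro positive_operator_emp_gramian sample_bounded)

lemma feature_sample_measurable: "1 \<le> i \<Longrightarrow> (\<lambda>\<omega>. k (\<xi> i \<omega>)) \<in> borel_measurable P"
  using measurable_compose[OF sample_measurable feature_measurable] .

lemma sample_gramian_measurable:
  assumes [measurable]: "z \<in> borel_measurable P"
  shows "(\<lambda>\<omega>. Wm m \<omega> (z \<omega>)) \<in> borel_measurable P"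
  unfolding emp_gramian_def
  by (intro borel_measurable_scaleR borel_measurable_sum borel_measurable_inner
      feature_sample_measurable assms) auto

text \<open>
  The events below involve the inverse of a random operator, whose measurability is not immediate.
  It follows from the approximation by Richardson iterates, each of which is built from inner
  products and linear combinations of the sampled features.
\<close>
lemma sample_resolvent_measurable:
  assumes z: "z \<in> borel_measurable P" and l: "l > 0"
  shows "(\<lambda>\<omega>. reg_inverse (Wm m \<omega>) l (z \<omega>)) \<in> borel_measurable P"
proof (rule borel_measurable_LIMSEQ_metric)
  show "(\<lambda>n. (richardson (Wm m \<omega>) (\<kappa>\<^sup>2) l (z \<omega>) ^^ n) 0) \<longlonglongrightarrow> reg_inverse (Wm m \<omega>) l (z \<omega>)"
    if "\<omega> \<in> space P" for \<omega>
    using positive_operator.richardson_tendsto[OF positive_operator_sample[OF that] l] .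
  show "(\<lambda>\<omega>. (richardson (Wm m \<omega>) (\<kappa>\<^sup>2) l (z \<omega>) ^^ n) 0) \<in> borel_measurable P" for n
  proof (induction n)
    case (Suc n)
    define h where "h \<omega> = (richardson (Wm m \<omega>) (\<kappa>\<^sup>2) l (z \<omega>) ^^ n) 0" for \<omega>
    have [measurable]: "h \<in> borel_measurable P"
      unfolding h_def by (rule Suc.IH)
    note [measurable] = z sample_gramian_measurable[of h m]
    show ?case
      unfolding funpow.simps o_apply h_def[symmetric] unfolding richardson_def by measurable
  qed simp
qed

lemma sample_reg_energy_measurable:
  assumes "l > 0"
  shows "(\<lambda>\<omega>. reg_energy (Wm m \<omega>) k l x) \<in> borel_measurable P"
proof -
  have "(\<lambda>\<omega>. Wm m \<omega> (k x)) \<in> borel_measurable P"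
    by (rule sample_gramian_measurable) simp
  then have [measurable]: "(\<lambda>\<omega>. reg_inverse (Wm m \<omega>) l (reg_inverse (Wm m \<omega>) l (Wm m \<omega> (k x))))
      \<in> borel_measurable P"
    using assms by (intro sample_resolvent_measurable)
  show ?thesis
    by (simp add: reg_energy_def numeral_2_eq_2)
qed

text \<open>
  The summands \<open>(u \<bullet> k (\<xi> i)) k (\<xi> i) - W u\<close> are independent, centred and bounded by \<open>2 \<kappa>\<^sup>2 \<parallel>u\<parallel>\<close>.
\<close>
lemma sample_gramian_concentration:
  assumes m: "1 \<le> m" and \<delta>: "0 < \<delta>" "\<delta> \<le> 1"
  shows "{\<omega> \<in> space P. 2 * \<kappa>\<^sup>2 * norm u * sqrt (2 * ln (2 / \<delta>) / m) < norm (Wm m \<omega> u - W u)} \<in> sets P"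
      (is "?bad \<in> sets P")
    and "P.prob {\<omega> \<in> space P. 2 * \<kappa>\<^sup>2 * norm u * sqrt (2 * ln (2 / \<delta>) / m) < norm (Wm m \<omega> u - W u)} \<le> \<delta>"
proof -
  note [measurable] = sample_gramian_measurable[of "\<lambda>_. u", simplified]
  show "?bad \<in> sets P"
    by measurable
  interpret W: positive_operator W "\<kappa>\<^sup>2"
    by (rule positive_operator_gramian)
  define G where "G x = (u \<bullet> k x) *\<^sub>R k x - W u" for x
  define c where "c = 2 * \<kappa>\<^sup>2 * norm u"
  have G: "G \<in> borel_measurable \<mu>"
    unfolding G_def by measurable
  have G_bound: "norm (G x) \<le> c" if "x \<in> space \<mu>" for x
    using norm_triangle_ineq4[of "(u \<bullet> k x) *\<^sub>R k x" "W u"] W.bounded[of u]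
      norm_rank_one_le[OF feature_bounded[OF that], of u]
    by (simp add: G_def c_def)
  have G_mean: "(\<integral>x. v \<bullet> G x \<partial>\<mu>) = 0" for v
  proof -
    have "(\<integral>x. v \<bullet> G x \<partial>\<mu>) = (\<integral>x. (u \<bullet> k x) * (k x \<bullet> v) - W u \<bullet> v \<partial>\<mu>)"
      by (intro Bochner_Integration.integral_cong) (simp_all add: G_def inner_commute[of v] inner_diff_left)
    also have "\<dots> = 0"
      using integrable_feature_product[of u v] by (simp add: gramian_inner prob_space)
    finally show ?thesis .
  qed
  define bound where "bound = c * sqrt (2 * ln (2 / \<delta>) / m)"
  have "P.prob {\<omega> \<in> space P. c * sqrt (2 * card {1..m} * ln (2 / \<delta>)) < norm (\<Sum>i\<in>{1..m}. G (\<xi> i \<omega>))} \<le> \<delta>"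
  proof (rule P.hilbert_hoeffding)
    have "P.indep_vars (\<lambda>_. borel) (\<lambda>i \<omega>. G (\<xi> i \<omega>)) {1..}"
      by (rule P.indep_vars_compose2[OF sample_indep]) (rule G)
    then show "P.indep_vars (\<lambda>_. borel) (\<lambda>i \<omega>. G (\<xi> i \<omega>)) {1..m}"
      by (rule P.indep_vars_subset) auto
    show "norm (G (\<xi> i \<omega>)) \<le> c" if "i \<in> {1..m}" "\<omega> \<in> space P" for i \<omega>
      using that by (intro G_bound measurable_space[OF sample_measurable]) auto
    show "P.expectation (\<lambda>\<omega>. v \<bullet> G (\<xi> i \<omega>)) = 0" if "i \<in> {1..m}" for i v
    proof -
      have "(\<integral>x. v \<bullet> G x \<partial>distr P \<mu> (\<xi> i)) = P.expectation (\<lambda>\<omega>. v \<bullet> G (\<xi> i \<omega>))"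
        using that G by (intro integral_distr sample_measurable) auto
      then show ?thesis
        using that by (simp add: sample_distr G_mean)
    qed
  qed (use \<delta> in auto)
  also have "{\<omega> \<in> space P. c * sqrt (2 * card {1..m} * ln (2 / \<delta>)) < norm (\<Sum>i\<in>{1..m}. G (\<xi> i \<omega>))} = ?bad"
  proof -
    have sum_eq: "(\<Sum>i\<in>{1..m}. G (\<xi> i \<omega>)) = m *\<^sub>R (Wm m \<omega> u - W u)" for \<omega>
      using m by (simp add: G_def emp_gramian_def sum_subtractf scaleR_diff_right sum_constant_scaleR)
    have "sqrt (2 * card {1..m} * ln (2 / \<delta>)) = sqrt ((real m)\<^sup>2 * (2 * ln (2 / \<delta>) / m))"
      using m by (simp add: power2_eq_square)
    also have "\<dots> = m * sqrt (2 * ln (2 / \<delta>) / m)"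
      by (simp only: real_sqrt_mult) simp
    finally have bound_eq: "c * sqrt (2 * card {1..m} * ln (2 / \<delta>)) = m * bound"
      by (simp add: bound_def)
    have "m * bound < norm (m *\<^sub>R d) \<longleftrightarrow> bound < norm d" for d :: 'h
      using m by simp
    then show ?thesis
      unfolding sum_eq bound_eq by (simp only: bound_def c_def)
  qed
  finally show "P.prob ?bad \<le> \<delta>" .
qed

text \<open>
  Each of the two deviations is allowed to fail with probability \<open>\<delta> / 2\<close>. Because \<open>\<delta> \<le> 1\<close>, replacing
  \<open>ln (2 / \<delta>)\<close> by \<open>ln (4 / \<delta>)\<close> costs at most a factor \<open>2\<close> under the square root, so the argument
  ends with the constant \<open>2\<close> where \<open>2 * sqrt 2\<close> is asserted.
\<close>
theorem reg_energy_concentration: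
  assumes l: "l > 0" and m: "1 \<le> m" and \<delta>: "0 < \<delta>" "\<delta> \<le> 1" and x: "norm (k x) \<le> \<kappa>"
  shows "1 - \<delta> \<le> P.prob {\<omega> \<in> space P. \<bar>reg_energy (Wm m \<omega>) k l x - reg_energy W k l x\<bar>
    \<le> 2 * sqrt 2 * \<kappa> ^ 4 * (l\<^sup>2 + \<kappa> ^ 4) / (l ^ 4 * sqrt m) * sqrt (ln (2 / \<delta>))}"
    (is "_ \<le> P.prob ?good")
proof -
  interpret W: positive_operator W "\<kappa>\<^sup>2"
    by (rule positive_operator_gramian)
  define w where "w = reg_inverse W l (reg_inverse W l (k x))"
  define r where "r = sqrt (2 * ln (2 / (\<delta> / 2)) / m)"
  define bad where "bad u = {\<omega> \<in> space P. 2 * \<kappa>\<^sup>2 * norm u * r < norm (Wm m \<omega> u - W u)}" for u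
  have bad: "bad u \<in> sets P" "P.prob (bad u) \<le> \<delta> / 2" for u
    unfolding bad_def r_def using m \<delta> by (intro sample_gramian_concentration; simp)+
  have "norm w \<le> norm (reg_inverse W l (k x)) / l"
    unfolding w_def by (rule W.norm_resolvent_le[OF l])
  also have "\<dots> \<le> norm (k x) / l / l"
    using l by (intro divide_right_mono W.norm_resolvent_le) auto
  also have "\<dots> \<le> \<kappa> / l\<^sup>2"
    using x l by (simp add: power2_eq_square divide_right_mono)
  finally have w: "norm w \<le> \<kappa> / l\<^sup>2" .
  have r: "0 \<le> r" "r \<le> 2 * sqrt (ln (2 / \<delta>)) / sqrt m"
  proof -
    have "ln (2 / (\<delta> / 2)) \<le> ln ((2 / \<delta>)\<^sup>2)"
      using \<delta> by (subst ln_le_cancel_iff) (auto simp: power2_eq_square field_simps)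
    also have "\<dots> = 2 * ln (2 / \<delta>)"
      using \<delta> by (simp add: ln_realpow)
    finally have "r \<le> sqrt (4 * ln (2 / \<delta>) / m)"
      unfolding r_def by (intro real_sqrt_le_mono divide_right_mono) auto
    also have "\<dots> = 2 * sqrt (ln (2 / \<delta>)) / sqrt m"
      by (simp add: real_sqrt_divide real_sqrt_mult)
    finally show "r \<le> 2 * sqrt (ln (2 / \<delta>)) / sqrt m" .
    show "0 \<le> r"
      using \<delta> by (simp add: r_def)
  qed
  have good: "?good \<in> sets P"
    using sample_reg_energy_measurable[OF l, of m x] by measurable
  have "space P - (bad (W w) \<union> bad w) \<subseteq> ?good"
  proof (intro subsetI CollectI conjI)
    fix \<omega>
    assume "\<omega> \<in> space P - (bad (W w) \<union> bad w)"
    then have \<omega>: "\<omega> \<in> space P"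
      and dev1: "norm (Wm m \<omega> (W w) - W (W w)) \<le> 2 * \<kappa>\<^sup>2 * norm (W w) * r"
      and dev2: "norm (Wm m \<omega> w - W w) \<le> 2 * \<kappa>\<^sup>2 * norm w * r"
      by (auto simp: bad_def not_less)
    show "\<omega> \<in> space P" by (rule \<omega>)
    define d where "d = (reg_inverse (Wm m \<omega>) l ^^ 2) (Wm m \<omega> (k x)) - (reg_inverse W l ^^ 2) (W (k x))"
    have "norm d \<le> \<kappa>\<^sup>2 / l\<^sup>2 * norm (Wm m \<omega> (W w) - W (W w)) + norm (Wm m \<omega> w - W w)"
      using tikhonov_perturbation[OF positive_operator_sample[OF \<omega>] W.positive_operator_axioms l]
      by (simp add: d_def w_def numeral_2_eq_2)
    also have "\<dots> \<le> \<kappa>\<^sup>2 / l\<^sup>2 * (2 * \<kappa>\<^sup>2 * norm (W w) * r) + 2 * \<kappa>\<^sup>2 * norm w * r"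
      by (intro add_mono mult_left_mono dev1 dev2) auto
    also have "\<dots> \<le> \<kappa>\<^sup>2 / l\<^sup>2 * (2 * \<kappa>\<^sup>2 * (\<kappa>\<^sup>2 * norm w) * r) + 2 * \<kappa>\<^sup>2 * norm w * r"
      using W.bounded[of w] r(1) by (intro add_mono mult_left_mono mult_right_mono) auto
    also have "\<dots> = (2 * \<kappa>\<^sup>2 * (\<kappa> ^ 4 / l\<^sup>2 + 1)) * norm w * r"
      by (simp add: algebra_simps flip: power_add)
    also have "\<dots> \<le> (2 * \<kappa>\<^sup>2 * (\<kappa> ^ 4 / l\<^sup>2 + 1)) * (\<kappa> / l\<^sup>2) * r"
      using w r(1) by (intro mult_left_mono mult_right_mono) auto
    finally have d: "norm d \<le> (2 * \<kappa>\<^sup>2 * (\<kappa> ^ 4 / l\<^sup>2 + 1)) * (\<kappa> / l\<^sup>2) * r" .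
    have "\<bar>reg_energy (Wm m \<omega>) k l x - reg_energy W k l x\<bar> = 1 / 2 * \<bar>d \<bullet> k x\<bar>"
      by (simp add: reg_energy_def d_def inner_diff_left abs_if)
    also have "\<dots> \<le> 1 / 2 * (norm d * \<kappa>)"
      using Cauchy_Schwarz_ineq2[of d "k x"] mult_left_mono[OF x, of "norm d"] by simp
    also have "\<dots> \<le> 1 / 2 * (((2 * \<kappa>\<^sup>2 * (\<kappa> ^ 4 / l\<^sup>2 + 1)) * (\<kappa> / l\<^sup>2) * r) * \<kappa>)"
      using d bound_nonneg by (intro mult_left_mono mult_right_mono) auto
    also have "\<dots> = \<kappa> ^ 4 * (l\<^sup>2 + \<kappa> ^ 4) / l ^ 4 * r"
      using l by (simp add: field_simps flip: power_Suc power_add) (simp add: algebra_simps eval_nat_numeral)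
    also have "\<dots> \<le> \<kappa> ^ 4 * (l\<^sup>2 + \<kappa> ^ 4) / l ^ 4 * (2 * sqrt (ln (2 / \<delta>)) / sqrt m)"
      using r(2) by (intro mult_left_mono) auto
    also have "\<dots> = 2 * \<kappa> ^ 4 * (l\<^sup>2 + \<kappa> ^ 4) / (l ^ 4 * sqrt m) * sqrt (ln (2 / \<delta>))"
      by simp
    also have "\<dots> \<le> 2 * sqrt 2 * \<kappa> ^ 4 * (l\<^sup>2 + \<kappa> ^ 4) / (l ^ 4 * sqrt m) * sqrt (ln (2 / \<delta>))"
      using \<delta> by (intro mult_right_mono divide_right_mono) (auto simp: mult_le_cancel_right1)
    finally show "\<bar>reg_energy (Wm m \<omega>) k l x - reg_energy W k l x\<bar>
      \<le> 2 * sqrt 2 * \<kappa> ^ 4 * (l\<^sup>2 + \<kappa> ^ 4) / (l ^ 4 * sqrt m) * sqrt (ln (2 / \<delta>))" .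
  qed
  then have "P.prob (space P - (bad (W w) \<union> bad w)) \<le> P.prob ?good"
    using good by (rule P.finite_measure_mono)
  moreover have "P.prob (space P - (bad (W w) \<union> bad w)) = 1 - P.prob (bad (W w) \<union> bad w)"
    using bad by (intro P.prob_compl) auto
  moreover have "P.prob (bad (W w) \<union> bad w) \<le> P.prob (bad (W w)) + P.prob (bad w)"
    using bad by (intro measure_Un_le)
  ultimately show ?thesis
    using bad(2)[of "W w"] bad(2)[of w] by linarith
qed

text \<open>
  Borel-Cantelli with failure probabilities \<open>2 / m\<^sup>2\<close>, for which \<open>ln (2 / \<delta>) = 2 ln m\<close>. They are
  admissible from \<open>m = 2\<close> on.
\<close>
lemma sample_gramian_rate:
  "AE \<omega> in P. eventually (\<lambda>m. norm (Wm m \<omega> u - W u)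
    \<le> 4 * \<kappa>\<^sup>2 * norm u * (sqrt (ln m) / sqrt m)) sequentially"
proof -
  define bad where "bad m = (if 2 \<le> m then
    {\<omega> \<in> space P. 2 * \<kappa>\<^sup>2 * norm u * sqrt (2 * ln (2 / (2 / (real m)\<^sup>2)) / m) < norm (Wm m \<omega> u - W u)}
    else {})" for m
  have \<delta>: "0 < 2 / (real m)\<^sup>2" "2 / (real m)\<^sup>2 \<le> 1" if "2 \<le> m" for m
    using that power_mono[of 2 "real m" 2] by (auto simp: divide_le_eq)
  have bad: "bad m \<in> sets P" "P.prob (bad m) \<le> 2 * inverse (real m ^ 2)" for m
  proof -
    have "bad m \<in> sets P \<and> P.prob (bad m) \<le> 2 / (real m)\<^sup>2"
    proof (cases "2 \<le> m")
      case True
      then have "1 \<le> m"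
        by simp
      then show ?thesis
        unfolding bad_def if_P[OF True]
        using sample_gramian_concentration[OF _ \<delta>[OF True]] by blast
    next
      case False
      then show ?thesis
        by (simp add: bad_def)
    qed
    then show "bad m \<in> sets P"
      by (rule conjunct1)
    from \<open>bad m \<in> sets P \<and> P.prob (bad m) \<le> 2 / (real m)\<^sup>2\<close>
    show "P.prob (bad m) \<le> 2 * inverse (real m ^ 2)"
      by (simp only: divide_inverse)
  qed
  have "summable (\<lambda>m. 2 * inverse (real m ^ 2))"
    by (intro summable_mult inverse_power_summable) simp
  then have "summable (\<lambda>m. P.prob (bad m))"
    by (rule summable_comparison_test'[where N = 0]) (simp add: bad(2))
  then have "AE \<omega> in P. eventually (\<lambda>m. \<omega> \<in> space P - bad m) sequentially"
    using bad(1) by (intro borel_cantelli_AE1) (auto simp: less_top[symmetric])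
  then show ?thesis
  proof eventually_elim
    case (elim \<omega>)
    with eventually_ge_at_top[of 2] show ?case
    proof eventually_elim
      case (elim m)
      have "sqrt (2 * ln (2 / (2 / (real m)\<^sup>2)) / m) = sqrt (4 * ln m / m)"
        using elim by (simp add: ln_realpow)
      also have "\<dots> = 2 * (sqrt (ln m) / sqrt m)"
        by (simp add: real_sqrt_divide real_sqrt_mult)
      finally show ?case
        using elim by (auto simp: bad_def not_less)
    qed
  qed
qed

text \<open>
  Approximating \<open>g\<close> by a sequence \<open>W (u n)\<close> leaves countably many null sets: one for \<open>g\<close>, one for each
  \<open>u n\<close>, and one for each draw that fails to be orthogonal to \<open>v - W g\<close>.
\<close>
theorem sample_tikhonov_tendsto:
  assumes lam_pos: "\<And>m. 1 \<le> m \<Longrightarrow> lam m > 0" and lam: "lam \<longlonglongrightarrow> 0"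
    and rate: "(\<lambda>m. sqrt (ln (real m)) / (lam m * sqrt (real m))) \<longlonglongrightarrow> 0"
    and g: "g \<in> closure (range W)" and v: "W (v - W g) = 0"
  shows "AE \<omega> in P. (\<lambda>m. (reg_inverse (Wm m \<omega>) (lam m) ^^ 2) (Wm m \<omega> v)) \<longlonglongrightarrow> g"
proof -
  obtain y where y: "\<And>n. y n \<in> range W" "y \<longlonglongrightarrow> g"
    using g unfolding closure_sequential by blast
  then have "\<forall>n. \<exists>u. y n = W u"
    by blast
  then obtain u where u: "\<And>n. y n = W (u n)"
    by metis
  have g_approx: "g \<in> closure (W ` range u)"
    unfolding closure_sequential using y(2) u by (intro exI[of _ y]) auto
  have ratio0: "(\<lambda>m. sqrt (ln (real m)) / sqrt (real m)) \<longlonglongrightarrow> 0"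
  proof (rule Lim_transform_eventually)
    show "(\<lambda>m. lam m * (sqrt (ln (real m)) / (lam m * sqrt (real m)))) \<longlonglongrightarrow> 0"
      using tendsto_mult[OF lam rate] by simp
    show "eventually (\<lambda>m. lam m * (sqrt (ln (real m)) / (lam m * sqrt (real m)))
        = sqrt (ln (real m)) / sqrt (real m)) sequentially"
      using eventually_ge_at_top[of 1]
    proof eventually_elim
      case (elim m)
      then show ?case
        using lam_pos[of m] by simp
    qed
  qed
  have "AE \<omega> in P. k (\<xi> i \<omega>) \<bullet> (v - W g) = 0" if "1 \<le> i" for i
  proof -
    have "AE x in distr P \<mu> (\<xi> i). k x \<bullet> (v - W g) = 0"
      unfolding sample_distr[OF that] by (rule feature_orthogonal_kernel[OF v])
    then show ?thesis
      by (rule AE_distrD[OF sample_measurable[OF that]])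
  qed
  then have "AE \<omega> in P. \<forall>i. 1 \<le> i \<longrightarrow> k (\<xi> i \<omega>) \<bullet> (v - W g) = 0"
    unfolding AE_all_countable by auto
  moreover have "AE \<omega> in P. \<forall>n. eventually (\<lambda>m. norm (Wm m \<omega> (u n) - W (u n))
      \<le> 4 * \<kappa>\<^sup>2 * norm (u n) * (sqrt (ln m) / sqrt m)) sequentially"
    unfolding AE_all_countable using sample_gramian_rate by blast
  moreover have "AE \<omega> in P. eventually (\<lambda>m. norm (Wm m \<omega> g - W g)
      \<le> 4 * \<kappa>\<^sup>2 * norm g * (sqrt (ln m) / sqrt m)) sequentially"
    by (rule sample_gramian_rate)
  moreover have "AE \<omega> in P. \<omega> \<in> space P"
    by (rule AE_space)
  ultimately show ?thesis
  proof eventually_elim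
    case (elim \<omega>)
    show ?case
    proof (rule tikhonov_tendsto[where W = W and M = "\<kappa>\<^sup>2", OF _ lam _ g_approx])
      have "Wm m \<omega> (v - W g) = 0" for m
        using elim(1) by (simp add: emp_gramian_def inner_commute)
      then show "eventually (\<lambda>m. positive_operator (Wm m \<omega>) (\<kappa>\<^sup>2) \<and> lam m > 0
          \<and> Wm m \<omega> (v - W g) = 0) sequentially"
        using positive_operator_sample[OF elim(4)] lam_pos
        by (intro eventually_sequentiallyI[of 1]) simp
      show "(\<lambda>m. norm (Wm m \<omega> g - W g) / lam m) \<longlonglongrightarrow> 0"
      proof (rule Lim_null_comparison)
        show "(\<lambda>m. 4 * \<kappa>\<^sup>2 * norm g * (sqrt (ln (real m)) / (lam m * sqrt (real m)))) \<longlonglongrightarrow> 0"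
          using tendsto_mult_left[OF rate, of "4 * \<kappa>\<^sup>2 * norm g"] by simp
        show "eventually (\<lambda>m. norm (norm (Wm m \<omega> g - W g) / lam m)
            \<le> 4 * \<kappa>\<^sup>2 * norm g * (sqrt (ln (real m)) / (lam m * sqrt (real m)))) sequentially"
          using elim(3) eventually_ge_at_top[of 1]
        proof eventually_elim
          case (elim m)
          then show ?case
            using lam_pos[of m] divide_right_mono[OF elim(1), of "lam m"] by (simp add: mult.commute)
        qed
      qed
      show "(\<lambda>m. Wm m \<omega> z) \<longlonglongrightarrow> W z" if z_range: "z \<in> range u" for z
      proof -
        obtain n where z: "z = u n"
          using z_range by blast
        have lim: "(\<lambda>m. 4 * \<kappa>\<^sup>2 * norm z * (sqrt (ln (real m)) / sqrt (real m))) \<longlonglongrightarrow> 0"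
          using tendsto_mult_left[OF ratio0, of "4 * \<kappa>\<^sup>2 * norm z"] by simp
        have "eventually (\<lambda>m. norm (Wm m \<omega> z - W z)
            \<le> 4 * \<kappa>\<^sup>2 * norm z * (sqrt (ln m) / sqrt m)) sequentially"
          using elim(2) unfolding z by (rule spec)
        then have "(\<lambda>m. Wm m \<omega> z - W z) \<longlonglongrightarrow> 0"
          using lim by (rule Lim_null_comparison)
        then show ?thesis
          by (rule LIM_zero_cancel)
      qed
    qed
  qed
qed

end

section \<open>Energy functions\<close>

lemma locally_lipschitz_imp_continuous_on:
  assumes "locally_lipschitz_on S f"
  shows "continuous_on S f"
  unfolding continuous_on_eq_continuous_within
proof
  fix x
  assume x: "x \<in> S"
  then obtain r L where r: "r > 0" and "lipschitz_on L (cball x r \<inter> S) f"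
    using assms unfolding locally_lipschitz_on_def by blast
  then have "continuous_on (cball x r \<inter> S) f"
    using lipschitz_on_continuous_on by blast
  then have "continuous (at x within (cball x r \<inter> S)) f"
    using x r by (simp add: continuous_on_eq_continuous_within)
  moreover have "at x within (cball x r \<inter> S) = at x within S"
    using r by (intro at_within_nhd[of _ "ball x r"]) auto
  ultimately show "continuous (at x within S) f"
    by (simp add: continuous_within)
qed

lemma rkhs_inner:
  assumes "rkhs X K evl k" "x \<in> X" "y \<in> X"
  shows "k x \<bullet> k y = K x y"
  using assms unfolding rkhs_def by metis

text \<open>
  The distance of two features is \<open>\<parallel>k y - k x\<parallel>\<^sup>2 = K y y - 2 K y x + K x x\<close>, so continuity of the kernel
  passes to the feature map, which is therefore Borel measurable.
\<close>
lemma rkhs_feature_continuous: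
  assumes rk: "rkhs X K evl k" and cont: "continuous_on (X \<times> X) (\<lambda>(x, y). K x y)"
  shows "continuous_on X k"
  unfolding continuous_on_def
proof
  fix x
  assume x: "x \<in> X"
  let ?F = "at x within X"
  have K: "((\<lambda>y. K (a y) (b y)) \<longlongrightarrow> K x x) ?F"
    if "continuous_on X a" "continuous_on X b" "\<And>y. y \<in> X \<Longrightarrow> a y \<in> X" "\<And>y. y \<in> X \<Longrightarrow> b y \<in> X"
      "a x = x" "b x = x" for a b
  proof -
    have "continuous_on X (\<lambda>y. (a y, b y))"
      using that by (intro continuous_intros)
    then have "continuous_on X (\<lambda>y. case (a y, b y) of (u, v) \<Rightarrow> K u v)"
      using that by (intro continuous_on_compose2[OF cont]) auto
    then show ?thesis
      using x that(5,6) by (force simp: continuous_on_def)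
  qed
  have "((\<lambda>y. K y y - 2 * K y x + K x x) \<longlongrightarrow> K x x - 2 * K x x + K x x) ?F"
    using x by (intro tendsto_intros K) auto
  then have lim: "((\<lambda>y. sqrt (K y y - 2 * K y x + K x x)) \<longlongrightarrow> 0) ?F"
    using tendsto_real_sqrt by fastforce
  have dist_K: "sqrt (K y y - 2 * K y x + K x x) = norm (k y - k x)" if "y \<in> X" for y
  proof -
    have "(k y - k x) \<bullet> (k y - k x) = k y \<bullet> k y - 2 * (k y \<bullet> k x) + k x \<bullet> k x"
      using inner_commute[of "k x" "k y"] by (simp add: inner_diff_left inner_diff_right)
    then show ?thesis
      using x that by (simp add: norm_eq_sqrt_inner rkhs_inner[OF rk])
  qed
  have "eventually (\<lambda>y. sqrt (K y y - 2 * K y x + K x x) = norm (k y - k x)) ?F"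
    using dist_K by (simp add: eventually_at_filter)
  then have "((\<lambda>y. norm (k y - k x)) \<longlongrightarrow> 0) ?F"
    by (rule Lim_transform_eventually[OF lim])
  then show "(k \<longlongrightarrow> k x) ?F"
    by (rule LIM_zero_cancel[OF tendsto_norm_zero_cancel])
qed

lemma energy_tendsto:
  assumes "((\<lambda>i. (reg_inverse (A i) (l i) ^^ 2) (A i (k x))) \<longlongrightarrow> pinv W (pinv W (W (k x)))) F"
  shows "((\<lambda>i. \<bar>reg_energy (A i) k (l i) x - energy W k x\<bar>) \<longlongrightarrow> 0) F"
proof -
  have "((\<lambda>i. reg_energy (A i) k (l i) x) \<longlongrightarrow> energy W k x) F"
    unfolding reg_energy_def energy_def by (intro tendsto_intros assms)
  then show ?thesis
    by (intro tendsto_rabs_zero LIM_zero)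
qed

theorem theorem4p2:
  fixes X :: "(real ^ 'n) set"
    and K :: "real ^ 'n \<Rightarrow> real ^ 'n \<Rightarrow> real"
    and evl :: "'h::{real_inner,complete_space,second_countable_topology} \<Rightarrow> real ^ 'n \<Rightarrow> real"
    and k :: "real ^ 'n \<Rightarrow> 'h"
    and \<mu> :: "(real ^ 'n) measure"
    and P :: "'w measure"
    and \<xi> :: "nat \<Rightarrow> 'w \<Rightarrow> real ^ 'n"
  assumes "compact X"
    and "psd_kernel X K"
    and "rkhs X K evl k"
    and "locally_lipschitz_on (X \<times> X) (\<lambda>(x, y). K x y)"
    and "(\<lambda>(x, y). K x y) \<in> borel_measurable (restrict_space borel X \<Otimes>\<^sub>M restrict_space borel X)"
    and "bdd_above ((\<lambda>x. K x x) ` X)"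
    and "completely_regular_rkhs X evl"
    and "prob_space \<mu>" and "sets \<mu> = sets (restrict_space borel X)"
    and "prob_space P"
    and "\<forall>i\<ge>1. \<xi> i \<in> measurable P \<mu>"
    and "\<forall>i\<ge>1. distr P \<mu> (\<xi> i) = \<mu>"
    and "prob_space.indep_vars P (\<lambda>_. \<mu>) \<xi> {1..}"
  defines "\<kappa> \<equiv> kernel_bound X K"
    and "W \<equiv> gramian \<mu> k"
    and "Wm \<equiv> (\<lambda>m \<omega>. emp_gramian k (\<lambda>i. \<xi> i \<omega>) m)"
  defines "cond \<equiv> (SUP x\<in>X. pinv_norm W (pinv W (W (k x)))) < \<infinity>"
  shows "(\<forall>l>0. \<forall>m\<ge>1. \<forall>\<delta>. 0 < \<delta> \<and> \<delta> \<le> 1 \<longrightarrow> (\<forall>x\<in>X.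
            measure P {\<omega> \<in> space P.
               \<bar>reg_energy (Wm m \<omega>) k l x - reg_energy W k l x\<bar>
                 \<le> 2 * sqrt 2 * \<kappa> ^ 4 * (l\<^sup>2 + \<kappa> ^ 4) / (l ^ 4 * sqrt (real m)) * sqrt (ln (2 / \<delta>))}
            \<ge> 1 - \<delta>)) \<and>
         (cond \<longrightarrow> (\<forall>x\<in>X.
            ((\<lambda>l. \<bar>reg_energy W k l x - energy W k x\<bar>) \<longlongrightarrow> 0) (at_right 0))) \<and>
         (cond \<longrightarrow> (\<forall>lam :: nat \<Rightarrow> real.
            (\<forall>m\<ge>1. lam m > 0) \<and> lam \<longlonglongrightarrow> 0 \<and>
            (\<lambda>m. sqrt (ln (real m)) / (lam m * sqrt (real m))) \<longlonglongrightarrow> 0 \<longrightarrow>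
            (\<forall>x\<in>X. AE \<omega> in P.
               (\<lambda>m. \<bar>reg_energy (Wm m \<omega>) k (lam m) x - energy W k x\<bar>) \<longlonglongrightarrow> 0)))"
proof -
  have space: "space \<mu> = X"
    using sets_eq_imp_space_eq[OF \<open>sets \<mu> = sets (restrict_space borel X)\<close>]
    by (simp add: space_restrict_space)
  have k_bound: "norm (k x) \<le> \<kappa>" if "x \<in> X" for x
  proof -
    have "norm (k x) = sqrt (K x x)"
      using that by (simp add: norm_eq_sqrt_inner rkhs_inner[OF \<open>rkhs X K evl k\<close>])
    also have "\<dots> \<le> \<kappa>"
      unfolding \<kappa>_def kernel_bound_def
      using that \<open>bdd_above ((\<lambda>x. K x x) ` X)\<close> by (intro real_sqrt_le_mono cSUP_upper)
    finally show ?thesis .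
  qed
  have "continuous_on X k"
    by (rule rkhs_feature_continuous[OF \<open>rkhs X K evl k\<close>
          locally_lipschitz_imp_continuous_on[OF \<open>locally_lipschitz_on (X \<times> X) _\<close>]])
  then have "k \<in> borel_measurable (restrict_space borel X)"
    by (rule borel_measurable_continuous_on_restrict)
  then have k_measurable: "k \<in> borel_measurable \<mu>"
    using \<open>sets \<mu> = _\<close> measurable_cong_sets by blast
  interpret feature_sample \<mu> k \<kappa> P \<xi>
    using assms k_measurable k_bound
    by (simp add: feature_sample_def bounded_feature_map_def bounded_feature_map_axioms_def
        feature_sample_axioms_def space)
  interpret W: positive_operator W "\<kappa>\<^sup>2"
    unfolding W_def by (rule positive_operator_gramian)
  have preimage: "pinv W (pinv W (W (k x))) \<in> closure (range W)"
    "W (k x - W (pinv W (pinv W (W (k x))))) = 0" if cond "x \<in> X" for x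
  proof -
    have "pinv_norm W (pinv W (W (k x))) < \<infinity>"
      using that unfolding cond_def by (meson SUP_upper le_less_trans)
    then have "pinv W (W (k x)) \<in> pinv_dom W"
      by (auto simp: pinv_norm_def split: if_splits)
    then show "pinv W (pinv W (W (k x))) \<in> closure (range W)"
      "W (k x - W (pinv W (pinv W (W (k x))))) = 0"
      by (rule W.pinv_pinv_range(1), rule W.pinv_pinv_range(2))
  qed
  show ?thesis
  proof (intro conjI impI allI ballI)
    fix l \<delta> :: real and m :: nat and x
    assume "l > 0" "1 \<le> m" "0 < \<delta> \<and> \<delta> \<le> 1" "x \<in> X"
    then show "measure P {\<omega> \<in> space P.
        \<bar>reg_energy (Wm m \<omega>) k l x - reg_energy W k l x\<bar>
          \<le> 2 * sqrt 2 * \<kappa> ^ 4 * (l\<^sup>2 + \<kappa> ^ 4) / (l ^ 4 * sqrt (real m)) * sqrt (ln (2 / \<delta>))}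
        \<ge> 1 - \<delta>"
      unfolding Wm_def W_def by (intro reg_energy_concentration k_bound) auto
  next
    fix x
    assume "cond" "x \<in> X"
    note g = preimage[OF this]
    show "((\<lambda>l. \<bar>reg_energy W k l x - energy W k x\<bar>) \<longlongrightarrow> 0) (at_right 0)"
    proof (intro energy_tendsto tikhonov_tendsto[where W = W and M = "\<kappa>\<^sup>2" and U = UNIV] g(1))
      show "eventually (\<lambda>l::real. positive_operator W (\<kappa>\<^sup>2) \<and> l > 0
          \<and> W (k x - W (pinv W (pinv W (W (k x))))) = 0) (at_right 0)"
        using eventually_at_right_less[of "0::real"] by (simp add: g(2) W.positive_operator_axioms)
      show "((\<lambda>l::real. l) \<longlongrightarrow> 0) (at_right 0)"
        by (rule tendsto_ident_at)
      show "((\<lambda>l::real. norm (W g - W g) / l) \<longlongrightarrow> 0) (at_right 0)" for g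
        unfolding diff_self norm_zero div_0 by (rule tendsto_const)
    qed (rule tendsto_const)
  next
    fix lam :: "nat \<Rightarrow> real" and x
    assume lam: "(\<forall>m\<ge>1. lam m > 0) \<and> lam \<longlonglongrightarrow> 0 \<and>
        (\<lambda>m. sqrt (ln (real m)) / (lam m * sqrt (real m))) \<longlonglongrightarrow> 0"
      and "cond" "x \<in> X"
    note g = preimage[OF \<open>cond\<close> \<open>x \<in> X\<close>]
    have "AE \<omega> in P. (\<lambda>m. (reg_inverse (Wm m \<omega>) (lam m) ^^ 2) (Wm m \<omega> (k x)))
        \<longlonglongrightarrow> pinv W (pinv W (W (k x)))"
      using lam g unfolding Wm_def W_def by (intro sample_tikhonov_tendsto) auto
    then show "AE \<omega> in P. (\<lambda>m. \<bar>reg_energy (Wm m \<omega>) k (lam m) x - energy W k x\<bar>) \<longlonglongrightarrow> 0"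
      by eventually_elim (rule energy_tendsto)
  qed
qed

end
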